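(* Let $d\ge 1$ be an integer, $h>0$, $\sigma>0$, and let $V=\{V_n\}_{n\in h\mathbb{Z}^d}$ be a bounded real-valued sequence with $\inf_{n\in h\mathbb{Z}^d}V_n>0$. Suppose that $(f,g)\in l^2_h\times l^2_h$ (real-valued) satisfies $E(f,g)<0$. Then the solution $u$ of the Cauchy problem for the focusing discrete nonlinear Klein-Gordon equation $$ \partial_t^2 u_n(t)-\Delta_h u_n(t)+V_n u_n(t)- |u_n(t)|^{2\sigma}u_n(t)=0,\qquad u_n(0)=f_n,\quad \partial_t u_n(0)=g_n,\qquad n\in h\mathbb{Z}^d, $$ blows up at a time $T_*<\infty$. Moreover, $$ \lim_{t\to T_*}\|u(t)\|_{l^2_h}=+\infty. $$
   Context: $\|u\|_{l^2_h}=\big(\sum_{n\in h\mathbb{Z}^d}|u_n|^2\big)^{1/2}$ and $l^2_h$ is the space of sequences on $h\mathbb{Z}^d$ with finite norm. The discrete Laplacian is $\Delta_h u_n=\sum_{j=1}^d h^{-2}(u_{n+he_j}+u_{n-he_j}-2u_n)$, with $(e_j)$ the canonical basis of $\mathbb{R}^d$. The solution is the unique real-valued solution with $(u,\partial_t u)$ continuous in time with values in $l^2_h\times l^2_h$, on its maximal interval of existence. It blows up in finite time $T_*$ if the maximal forward existence time is $T_*<\infty$ and the norm of $(u,\partial_t u)$ in $l^2_h\times l^2_h$ tends to $+\infty$ as $t\to T_*$. The energy (conserved, here for the focusing sign $\lambda=-1$) is $$E(u,\partial_t u)=\frac12\sum_{n\in h\mathbb{Z}^d}\Big(|\partial_t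 u_n|^2+\frac1{h^2}\sum_{j=1}^d (u_{n+he_j}-u_n)^2+V_n|u_n|^2-\frac{1}{\sigma+1}|u_n|^{2\sigma+2}\Big),$$ and $E(f,g)$ is this expression with $u=f$, $\partial_t u=g$. *)

theory Defs
  imports "HOL-Analysis.Analysis"
begin

text \<open>
  A lattice sequence on \<open>h\<int>\<^sup>d\<close> is represented as a function on \<open>\<int>\<^sup>d\<close> (type \<open>int ^ 'd\<close>,
  with \<open>d = CARD('d) \<ge> 1\<close>) through the bijection \<open>k \<mapsto> h k\<close>: the value at \<open>k\<close> is the
  value at the lattice point \<open>n = h k\<close>, and the shift \<open>n + h e\<^sub>j\<close> becomes \<open>k + axis j 1\<close>.
  The mesh size enters through the difference quotients only; as in the source, the
  \<open>l\<^sup>2\<^sub>h\<close> norm and the energy carry no weight \<open>h\<^sup>d\<close>.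
\<close>

type_synonym 'd lattice_fun = "int ^ 'd \<Rightarrow> real"

definition l2 :: "'d::finite lattice_fun set" where
  "l2 = {u. (\<lambda>n. \<bar>u n\<bar>\<^sup>2) summable_on UNIV}"

definition l2_norm :: "'d::finite lattice_fun \<Rightarrow> real" where
  "l2_norm u = sqrt (\<Sum>\<^sub>\<infinity>n. \<bar>u n\<bar>\<^sup>2)"

definition l2_pair_norm :: "'d::finite lattice_fun \<Rightarrow> 'd lattice_fun \<Rightarrow> real" where
  "l2_pair_norm u v = sqrt ((l2_norm u)\<^sup>2 + (l2_norm v)\<^sup>2)"

definition l2_continuous_on :: "real set \<Rightarrow> (real \<Rightarrow> 'd::finite lattice_fun) \<Rightarrow> bool" where
  "l2_continuous_on I u \<longleftrightarrow>
     (\<forall>t\<in>I. u t \<in> l2) \<and>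
     (\<forall>t\<in>I. ((\<lambda>s. l2_norm (\<lambda>n. u s n - u t n)) \<longlongrightarrow> 0) (at t within I))"

definition discrete_laplacian :: "real \<Rightarrow> 'd::finite lattice_fun \<Rightarrow> 'd lattice_fun" where
  "discrete_laplacian h u n =
     (\<Sum>j\<in>UNIV. (u (n + axis j 1) + u (n - axis j 1) - 2 * u n) / h\<^sup>2)"

definition energy ::
  "real \<Rightarrow> real \<Rightarrow> 'd::finite lattice_fun \<Rightarrow> 'd lattice_fun \<Rightarrow> 'd lattice_fun \<Rightarrow> real" where
  "energy h \<sigma> V u v = 1/2 * (\<Sum>\<^sub>\<infinity>n.
      \<bar>v n\<bar>\<^sup>2 + 1 / h\<^sup>2 * (\<Sum>j\<in>UNIV. (u (n + axis j 1) - u n)\<^sup>2) + V n * \<bar>u n\<bar>\<^sup>2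
      - 1 / (\<sigma> + 1) * \<bar>u n\<bar> powr (2 * \<sigma> + 2))"

definition time_deriv :: "(real \<Rightarrow> 'd::finite lattice_fun) \<Rightarrow> real \<Rightarrow> 'd lattice_fun" where
  "time_deriv u t n = deriv (\<lambda>s. u s n) t"

text \<open>
  Solutions live on open intervals containing the initial time \<open>0\<close>. Time derivatives are
  taken at each lattice site; the values of \<open>u\<close> outside \<open>I\<close> are irrelevant.
\<close>

definition nlkg_solution ::
  "real \<Rightarrow> real \<Rightarrow> 'd::finite lattice_fun \<Rightarrow> 'd lattice_fun \<Rightarrow> 'd lattice_fun
    \<Rightarrow> real set \<Rightarrow> (real \<Rightarrow> 'd lattice_fun) \<Rightarrow> bool" where
  "nlkg_solution h \<sigma> V f g I u \<longleftrightarrow>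
     open I \<and> is_interval I \<and> 0 \<in> I \<and>
     l2_continuous_on I u \<and> l2_continuous_on I (time_deriv u) \<and>
     (\<forall>t\<in>I. \<forall>n.
        (\<lambda>s. u s n) differentiable (at t) \<and>
        (\<lambda>s. time_deriv u s n) differentiable (at t) \<and>
        time_deriv (time_deriv u) t n - discrete_laplacian h (u t) n + V n * u t n
          - \<bar>u t n\<bar> powr (2 * \<sigma>) * u t n = 0) \<and>
     (\<forall>n. u 0 n = f n) \<and> (\<forall>n. time_deriv u 0 n = g n)"

definition maximal_nlkg_solution ::
  "real \<Rightarrow> real \<Rightarrow> 'd::finite lattice_fun \<Rightarrow> 'd lattice_fun \<Rightarrow> 'd lattice_fun
    \<Rightarrow> real set \<Rightarrow> (real \<Rightarrow> 'd lattice_fun) \<Rightarrow> bool" where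
  "maximal_nlkg_solution h \<sigma> V f g I u \<longleftrightarrow>
     nlkg_solution h \<sigma> V f g I u \<and>
     (\<forall>J w. nlkg_solution h \<sigma> V f g J w \<and> I \<subseteq> J \<and> (\<forall>t\<in>I. w t = u t) \<longrightarrow> J = I)"

text \<open>Here \<open>I\<close> is meant to be the maximal interval of existence of \<open>u\<close>.\<close>

definition blows_up_at :: "real set \<Rightarrow> (real \<Rightarrow> 'd::finite lattice_fun) \<Rightarrow> real \<Rightarrow> bool" where
  "blows_up_at I u T \<longleftrightarrow>
     bdd_above I \<and> T = Sup I \<and>
     filterlim (\<lambda>t. l2_pair_norm (u t) (time_deriv u t)) at_top (at_left T)"

end

theory Submission
  imports Defs
begin

text \<open>
  The equation is an autonomous first order system for \<open>(u, \<partial>\<^sub>t u)\<close> in the Hilbert space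
  \<open>l\<^sup>2 \<times> l\<^sup>2\<close> with a locally Lipschitz right-hand side, because \<open>l\<^sup>2\<close> embeds in
  \<open>l\<^sup>\<infinity>\<close>; hence a unique maximal solution exists, and its norm tends to infinity at a finite
  end point. Write \<open>A = - \<Delta>\<^sub>h + V\<close> and let \<open>E\<close> be the conserved energy. Then
  \<open>\<phi> = \<parallel>u\<parallel>\<^sup>2\<close> satisfies
  \<open>\<phi>'' = (2 \<sigma> + 4) \<parallel>\<partial>\<^sub>t u\<parallel>\<^sup>2 + 2 \<sigma> \<langle>A u, u\<rangle> - 4 (\<sigma> + 1) E\<close>,
  so for \<open>E < 0\<close> it is eventually increasing and \<open>\<phi> \<phi>'' \<ge> (1 + \<sigma> / 2) \<phi>'\<^sup>2\<close> by
  Cauchy-Schwarz: a positive concave decreasing function \<open>\<phi> powr (- \<sigma> / 2)\<close> cannot live for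
  all times. Finally \<open>E < 0\<close> bounds \<open>\<parallel>\<partial>\<^sub>t u\<parallel>\<close> by a function of \<open>\<parallel>u\<parallel>\<close>, so it is
  \<open>\<parallel>u\<parallel>\<close> itself that blows up.
\<close>

section \<open>The Hilbert space of square summable families\<close>

lemma summable_on_mult_of_squares:
  fixes u w :: "'a \<Rightarrow> real"
  assumes "(\<lambda>n. (u n)\<^sup>2) summable_on A" "(\<lambda>n. (w n)\<^sup>2) summable_on A"
  shows "(\<lambda>n. u n * w n) summable_on A"
proof -
  have "(\<lambda>n. ((u n)\<^sup>2 + (w n)\<^sup>2) / 2) summable_on A"
    using summable_on_cmult_right[OF summable_on_add[OF assms], of "1/2"] by simp
  then have "(\<lambda>n. norm (u n * w n)) summable_on A"
  proof (rule summable_on_comparison_test)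
    fix n
    have "2 * (\<bar>u n\<bar> * \<bar>w n\<bar>) \<le> (u n)\<^sup>2 + (w n)\<^sup>2"
      using sum_squares_bound[of "\<bar>u n\<bar>" "\<bar>w n\<bar>"] by simp
    then show "norm (u n * w n) \<le> ((u n)\<^sup>2 + (w n)\<^sup>2) / 2"
      by (simp add: abs_mult)
  qed auto
  then show ?thesis
    by (rule abs_summable_summable)
qed

lemma summable_on_square_add:
  fixes u w :: "'a \<Rightarrow> real"
  assumes "(\<lambda>n. (u n)\<^sup>2) summable_on A" "(\<lambda>n. (w n)\<^sup>2) summable_on A"
  shows "(\<lambda>n. (u n + w n)\<^sup>2) summable_on A"
proof -
  have "(\<lambda>n. ((u n)\<^sup>2 + (w n)\<^sup>2) + 2 * (u n * w n)) summable_on A"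
    by (intro summable_on_add summable_on_cmult_right summable_on_mult_of_squares assms)
  then show ?thesis
    by (simp add: power2_sum mult.assoc)
qed

text \<open>Square summable families form a type here so that the classes \<open>real_inner\<close>
  and \<open>banach\<close> supply the calculus of Hilbert space valued curves. The index type is
  arbitrary; the lattice is the case \<open>int ^ 'd\<close>.\<close>

typedef 'a ell2 = "{u :: 'a \<Rightarrow> real. (\<lambda>n. (u n)\<^sup>2) summable_on UNIV}"
  morphisms coord Abs_ell2
  by (rule exI[of _ "\<lambda>_. 0"]) simp

setup_lifting type_definition_ell2

lemma coord_square_summable: "(\<lambda>n. (coord x n)\<^sup>2) summable_on UNIV"
  by transfer

lemma coord_mult_summable: "(\<lambda>n. coord x n * coord y n) summable_on UNIV"
  by (intro summable_on_mult_of_squares coord_square_summable)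

lemma ell2_eqI: "(\<And>n. coord x n = coord y n) \<Longrightarrow> x = y"
  by (metis coord_inject ext)

instantiation ell2 :: (type) real_vector
begin

lift_definition zero_ell2 :: "'a ell2" is "\<lambda>_. 0" by simp

lift_definition plus_ell2 :: "'a ell2 \<Rightarrow> 'a ell2 \<Rightarrow> 'a ell2" is "\<lambda>u w n. u n + w n"
  by (rule summable_on_square_add)

lift_definition uminus_ell2 :: "'a ell2 \<Rightarrow> 'a ell2" is "\<lambda>u n. - u n" by simp

lift_definition minus_ell2 :: "'a ell2 \<Rightarrow> 'a ell2 \<Rightarrow> 'a ell2" is "\<lambda>u w n. u n - w n"
  using summable_on_square_add[of _ UNIV "\<lambda>n. - _ n"] by simp

lift_definition scaleR_ell2 :: "real \<Rightarrow> 'a ell2 \<Rightarrow> 'a ell2" is "\<lambda>c u n. c * u n"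
  by (auto simp: power_mult_distrib intro: summable_on_cmult_right)

instance
  by standard (transfer; auto simp: algebra_simps)+

end

lemmas coord_simps [simp] =
  zero_ell2.rep_eq plus_ell2.rep_eq uminus_ell2.rep_eq minus_ell2.rep_eq scaleR_ell2.rep_eq

instantiation ell2 :: (type) real_inner
begin

lift_definition inner_ell2 :: "'a ell2 \<Rightarrow> 'a ell2 \<Rightarrow> real" is
  "\<lambda>u w. \<Sum>\<^sub>\<infinity>n. u n * w n" .

definition norm_ell2 :: "'a ell2 \<Rightarrow> real" where
  "norm_ell2 x = sqrt (inner x x)"

definition sgn_ell2 :: "'a ell2 \<Rightarrow> 'a ell2" where
  "sgn_ell2 x = x /\<^sub>R norm x"

definition dist_ell2 :: "'a ell2 \<Rightarrow> 'a ell2 \<Rightarrow> real" where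
  "dist_ell2 x y = norm (x - y)"

definition uniformity_ell2 :: "('a ell2 \<times> 'a ell2) filter" where
  "uniformity_ell2 = (INF e\<in>{0 <..}. principal {(x, y). dist x y < e})"

definition open_ell2 :: "'a ell2 set \<Rightarrow> bool" where
  "open_ell2 U \<longleftrightarrow> (\<forall>x\<in>U. \<forall>\<^sub>F (x', y) in uniformity. x' = x \<longrightarrow> y \<in> U)"

instance
proof
  fix x y z :: "'a ell2" and r :: real
  show "inner x y = inner y x"
    by (simp add: inner_ell2.rep_eq mult.commute)
  show "inner (x + y) z = inner x z + inner y z"
    by (simp add: inner_ell2.rep_eq distrib_right infsum_add coord_mult_summable)
  show "inner (r *\<^sub>R x) y = r * inner x y"
    by (simp add: inner_ell2.rep_eq mult.assoc infsum_cmult_right')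
  show "0 \<le> inner x x"
    by (simp add: inner_ell2.rep_eq infsum_nonneg)
  show "inner x x = 0 \<longleftrightarrow> x = 0"
  proof
    assume "inner x x = 0"
    then have "coord x n * coord x n = 0" for n
      using nonneg_infsum_le_0D[of "\<lambda>n. coord x n * coord x n" UNIV n]
        coord_mult_summable[of x x] by (simp add: inner_ell2.rep_eq)
    then show "x = 0"
      by (intro ell2_eqI) simp
  qed (simp add: inner_ell2.rep_eq)
qed (fact dist_ell2_def sgn_ell2_def uniformity_ell2_def open_ell2_def norm_ell2_def)+

end

lemma norm_ell2_square: "(norm x)\<^sup>2 = (\<Sum>\<^sub>\<infinity>n. (coord x n)\<^sup>2)"
  unfolding power2_norm_eq_inner by (simp add: inner_ell2.rep_eq power2_eq_square)

text \<open>This is the embedding of square summable into bounded families. It makes the coordinates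
  bounded linear functionals and the power nonlinearity Lipschitz on balls.\<close>

lemma abs_coord_le_norm: "\<bar>coord x n\<bar> \<le> norm x"
proof -
  have "(\<Sum>\<^sub>\<infinity>m\<in>{n}. (coord x m)\<^sup>2) \<le> (\<Sum>\<^sub>\<infinity>m. (coord x m)\<^sup>2)"
    by (intro infsum_mono_neutral coord_square_summable) auto
  then have "\<bar>coord x n\<bar>\<^sup>2 \<le> (norm x)\<^sup>2"
    by (simp add: norm_ell2_square)
  then show ?thesis
    by (rule power2_le_imp_le) simp
qed

lemma bounded_linear_coord: "bounded_linear (\<lambda>x. coord x n)"
  by (rule bounded_linear_intro[of _ 1]) (use abs_coord_le_norm in auto)

lemma sum_coord_square_le: "finite F \<Longrightarrow> (\<Sum>n\<in>F. (coord x n)\<^sup>2) \<le> (norm x)\<^sup>2"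
  using finite_sum_le_infsum[OF coord_square_summable, of F x]
  by (simp add: norm_ell2_square)

lemma norm_le_of_sums:
  assumes "\<And>F. finite F \<Longrightarrow> (\<Sum>n\<in>F. (coord x n)\<^sup>2) \<le> B\<^sup>2" "0 \<le> B"
  shows "norm x \<le> B"
proof -
  have "(norm x)\<^sup>2 \<le> B\<^sup>2"
    unfolding norm_ell2_square
    by (rule infsum_le_finite_sums) (use assms coord_square_summable in auto)
  then show ?thesis
    using assms(2) by (rule power2_le_imp_le)
qed

instance ell2 :: (type) banach
proof
  fix X :: "nat \<Rightarrow> 'a ell2"
  assume X: "Cauchy X"
  have "Cauchy (\<lambda>k. coord (X k) n)" for n
    using bounded_linear.Cauchy[OF bounded_linear_coord X] .
  then have "\<exists>a. (\<lambda>k. coord (X k) n) \<longlonglongrightarrow> a" for n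
    by (simp add: Cauchy_convergent_iff convergent_def)
  then obtain a where a: "\<And>n. (\<lambda>k. coord (X k) n) \<longlonglongrightarrow> a n"
    by metis
  \<comment> \<open>The Cauchy estimate is stated on finite sets of sites, where the limit in
    \<open>m\<close> may be taken termwise; \<open>N\<close> does not depend on \<open>F\<close>, so
    the estimate survives for the full norm.\<close>
  have ev: "\<exists>N. \<forall>k\<ge>N. \<forall>F. finite F \<longrightarrow> (\<Sum>n\<in>F. (coord (X k) n - a n)\<^sup>2) \<le> e\<^sup>2"
    if "e > 0" for e
  proof -
    from X that obtain N where N: "\<And>k m. k \<ge> N \<Longrightarrow> m \<ge> N \<Longrightarrow> norm (X k - X m) < e"
      unfolding Cauchy_iff by blast
    have "(\<Sum>n\<in>F. (coord (X k) n - a n)\<^sup>2) \<le> e\<^sup>2" if "k \<ge> N" "finite F" for k F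
    proof (rule tendsto_upperbound)
      show "(\<lambda>m. \<Sum>n\<in>F. (coord (X k) n - coord (X m) n)\<^sup>2)
              \<longlonglongrightarrow> (\<Sum>n\<in>F. (coord (X k) n - a n)\<^sup>2)"
        by (intro tendsto_intros a)
      show "\<forall>\<^sub>F m in sequentially. (\<Sum>n\<in>F. (coord (X k) n - coord (X m) n)\<^sup>2) \<le> e\<^sup>2"
        using eventually_ge_at_top[of N]
      proof eventually_elim
        case (elim m)
        have "(\<Sum>n\<in>F. (coord (X k - X m) n)\<^sup>2) \<le> (norm (X k - X m))\<^sup>2"
          using that by (intro sum_coord_square_le)
        also have "\<dots> \<le> e\<^sup>2"
          using N[OF that(1) elim] by (intro power_mono) auto
        finally show ?case by simp
      qed
    qed simp
    then show ?thesis by blast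
  qed
  obtain N where N: "\<And>F. finite F \<Longrightarrow> (\<Sum>n\<in>F. (coord (X N) n - a n)\<^sup>2) \<le> 1"
    using ev[of 1] by auto
  have "(\<lambda>n. (coord (X N) n - a n)\<^sup>2) summable_on UNIV"
    by (rule nonneg_bdd_above_summable_on) (auto intro!: bdd_aboveI[of _ 1] N)
  \<comment> \<open>Adding \<open>- X N\<close> and \<open>X N - a\<close> leaves
    \<open>- a\<close>, whose square is that of \<open>a\<close>.\<close>
  from summable_on_square_add[OF coord_square_summable[of "- X N"] this]
  have "(\<lambda>n. (a n)\<^sup>2) summable_on UNIV"
    by simp
  then obtain x where x: "coord x = a"
    by (metis Abs_ell2_inverse mem_Collect_eq)
  have "X \<longlonglongrightarrow> x"
  proof (rule metric_LIMSEQ_I)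
    fix e :: real assume "e > 0"
    then obtain M where M: "\<And>k F. k \<ge> M \<Longrightarrow> finite F \<Longrightarrow>
        (\<Sum>n\<in>F. (coord (X k) n - a n)\<^sup>2) \<le> (e/2)\<^sup>2"
      using ev[of "e/2"] by auto
    have "norm (X k - x) \<le> e/2" if "k \<ge> M" for k
      by (rule norm_le_of_sums) (use M[OF that] x \<open>e > 0\<close> in auto)
    then show "\<exists>M. \<forall>k\<ge>M. dist (X k) x < e"
      using \<open>e > 0\<close> by (intro exI[of _ M]) (force simp: dist_norm)
  qed
  then show "convergent X"
    by (auto simp: convergent_def)
qed

section \<open>Maximal solutions of autonomous equations in a Hilbert space\<close>

definition ode_solution ::
  "('a::real_normed_vector \<Rightarrow> 'a) \<Rightarrow> 'a \<Rightarrow> real set \<Rightarrow> (real \<Rightarrow> 'a) \<Rightarrow> bool" where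
  "ode_solution G y0 I y \<longleftrightarrow>
     open I \<and> is_interval I \<and> 0 \<in> I \<and> y 0 = y0 \<and>
     (\<forall>t\<in>I. (y has_vector_derivative G (y t)) (at t))"

text \<open>Balls of an infinite-dimensional space are not compact, so a Lipschitz condition near
  each point would not yield an existence time common to a whole ball; hence one constant per ball
  is demanded. The inner product serves uniqueness, where the squared distance of two solutions is
  differentiated.\<close>

locale lipschitz_field =
  fixes G :: "'a::{real_inner, banach} \<Rightarrow> 'a"
  assumes lipschitz_on_balls: "\<And>R. \<exists>L. L-lipschitz_on (cball 0 R) G"
begin

section \<open>Local existence by Picard iteration\<close>

lemma bounded_on_ball: "\<exists>M\<ge>0. \<forall>x\<in>cball 0 R. norm (G x) \<le> M"
proof -
  obtain L where L: "L-lipschitz_on (cball 0 R) G"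
    using lipschitz_on_balls by blast
  have "norm (G x) \<le> norm (G 0) + L * \<bar>R\<bar>" if x: "x \<in> cball 0 R" for x
  proof -
    have "0 \<le> R" using x norm_ge_zero order_trans by (metis mem_cball_0)
    then have "norm (G x - G 0) \<le> L * norm x"
      using lipschitz_onD[OF L x, of 0] by (simp add: dist_norm)
    also have "\<dots> \<le> L * \<bar>R\<bar>"
      using x lipschitz_on_nonneg[OF L] by (intro mult_left_mono) auto
    finally show ?thesis
      using norm_triangle_sub[of "G x" "G 0"] by simp
  qed
  then show ?thesis
    using lipschitz_on_nonneg[OF L] by (intro exI[of _ "norm (G 0) + L * \<bar>R\<bar>"]) auto
qed

text \<open>The integral operator is a contraction on curves that stay within distance 1 of
  \<open>y0\<close>. The quantifier order matters: \<tau> depends on \<open>R\<close> alone, so a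
  solution of norm at most \<open>R\<close> can always be prolonged by the same amount of
  time.\<close>

lemma local_solution:
  "\<exists>\<tau>>0. \<forall>y0. norm y0 \<le> R \<longrightarrow>
     (\<exists>y. y 0 = y0 \<and> (\<forall>t. \<bar>t\<bar> < \<tau> \<longrightarrow> (y has_vector_derivative G (y t)) (at t)))"
proof -
  obtain L where L: "L-lipschitz_on (cball 0 (R + 1)) G"
    using lipschitz_on_balls by blast
  obtain M where M: "M \<ge> 0" "\<And>x. x \<in> cball 0 (R + 1) \<Longrightarrow> norm (G x) \<le> M"
    using bounded_on_ball by blast
  have L0: "L \<ge> 0" using L by (rule lipschitz_on_nonneg)
  \<comment> \<open>The integral operator is bounded below by the crude factor 3 \<tau>. The choice
    of \<tau> keeps its values in the unit ball about \<open>y0\<close> and gives the contraction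
    constant 3/4; the summand 1 keeps the denominator positive.\<close>
  define \<tau> where "\<tau> = 1 / (4 * (M + L + 1))"
  have \<tau>: "\<tau> > 0" "3 * \<tau> * M \<le> 1" "3 * \<tau> * L \<le> 3/4"
    using M(1) L0 by (auto simp: \<tau>_def field_simps)
  show ?thesis
  proof (intro exI[of _ \<tau>] conjI allI impI)
    fix y0 :: 'a assume y0: "norm y0 \<le> R"
    \<comment> \<open>Bounded continuous curves on the whole line form a complete space. Only their
      values on [-\<tau>, \<tau>] matter; \<open>clamp\<close> extends the image of a curve by
      constants outside.\<close>
    define S :: "(real \<Rightarrow>\<^sub>C 'a) set" where "S = PiC UNIV (\<lambda>_. cball y0 1)"
    \<comment> \<open>This is the integral from 0 to \<open>t\<close> for either sign of
      \<open>t\<close>, written with a common lower end -\<tau>. The two pieces have lengths at most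
      2 \<tau> and \<tau>, whence the factor 3 \<tau>.\<close>
    define J where "J x t = integral {-\<tau>..t} (G \<circ> x) - integral {-\<tau>..0} (G \<circ> x)" for x t
    have val: "apply_bcontfun x t \<in> cball y0 1" if "x \<in> S" for x t
      using that by (auto simp: S_def mem_PiC_iff)
    have sub: "cball y0 1 \<subseteq> cball 0 (R + 1)"
    proof
      fix x assume "x \<in> cball y0 1"
      then have "norm (y0 - x) \<le> 1" by (simp add: dist_norm)
      then show "x \<in> cball 0 (R + 1)"
        using y0 norm_triangle_ineq4[of y0 "y0 - x"] by simp
    qed
    have cont: "continuous_on A (G \<circ> apply_bcontfun x)" if "x \<in> S" for A x
      using val[OF that] sub
      by (intro continuous_on_compose continuous_on_apply_bcontfun
          continuous_on_subset[OF lipschitz_on_continuous_on[OF L]]) auto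
    have bnd: "norm (integral {-\<tau>..t} f - integral {-\<tau>..0} f) \<le> 3 * \<tau> * B"
      if f: "continuous_on {-\<tau>..\<tau>} f" "\<And>s. s \<in> {-\<tau>..\<tau>} \<Longrightarrow> norm (f s) \<le> B"
        and t: "t \<in> {-\<tau>..\<tau>}" for f :: "real \<Rightarrow> 'a" and B t
    proof -
      have B: "B \<ge> 0" using f(2)[of 0] \<tau>(1) norm_ge_zero order_trans
        by (metis abs_of_nonneg abs_le_iff atLeastAtMost_iff less_eq_real_def neg_le_0_iff_le)
      have 1: "norm (integral {-\<tau>..s} f) \<le> B * (s + \<tau>)" if "s \<in> {-\<tau>..\<tau>}" for s
      proof -
        have "norm (integral {-\<tau>..s} f) \<le> B * (s - - \<tau>)"
          using that by (intro integral_bound continuous_on_subset[OF f(1)] f(2)) auto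
        then show ?thesis by simp
      qed
      have "norm (integral {-\<tau>..t} f - integral {-\<tau>..0} f) \<le> B * (t + \<tau>) + B * (0 + \<tau>)"
        by (intro norm_triangle_le_diff add_mono 1) (use t \<tau> in auto)
      also have "\<dots> \<le> B * (2 * \<tau>) + B * \<tau>"
        using t B by (intro add_mono mult_left_mono) auto
      finally show ?thesis by (simp add: algebra_simps)
    qed
    have intg: "(G \<circ> apply_bcontfun x) integrable_on {-\<tau>..t}" if "x \<in> S" for x t
      by (rule integrable_continuous_real[OF cont[OF that]])
    have deriv: "(J x has_vector_derivative G (x t)) (at t within {-\<tau>..\<tau>})"
      if "x \<in> S" "t \<in> {-\<tau>..\<tau>}" for x t
      unfolding J_def
      using integral_has_vector_derivative[OF cont[OF that(1)] that(2)]
      by (auto intro: has_vector_derivative_diff_const[THEN iffD2])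
    have "\<exists>g\<in>S. \<forall>t. apply_bcontfun g t = y0 + J x (clamp (-\<tau>) \<tau> t)" if x: "x \<in> S" for x
    proof -
      have "continuous_on (cbox (-\<tau>) \<tau>) (\<lambda>t. y0 + J x t)"
        unfolding cbox_interval
        by (intro continuous_intros continuous_on_vector_derivative[OF deriv[OF x]])
      then obtain g where g: "\<And>t. apply_bcontfun g t = y0 + J x (clamp (-\<tau>) \<tau> t)"
        by (rule continuous_on_cbox_bcontfunE) (rule that)
      have "apply_bcontfun g t \<in> cball y0 1" for t
      proof -
        have "clamp (-\<tau>) \<tau> t \<in> {-\<tau>..\<tau>}"
          using clamp_in_interval[of "-\<tau>" \<tau> t] \<tau>(1) by simp
        then have "norm (J x (clamp (-\<tau>) \<tau> t)) \<le> 3 * \<tau> * M"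
          unfolding J_def using val[OF x] sub
          by (intro bnd cont[OF x]) (auto intro!: M(2))
        then show ?thesis
          using \<tau>(2) by (simp add: g dist_norm)
      qed
      then have "g \<in> S" by (simp add: S_def mem_PiC_iff)
      with g show ?thesis by blast
    qed
    then obtain \<Phi> where \<Phi>: "\<And>x. x \<in> S \<Longrightarrow> \<Phi> x \<in> S"
      "\<And>x t. x \<in> S \<Longrightarrow> apply_bcontfun (\<Phi> x) t = y0 + J x (clamp (-\<tau>) \<tau> t)"
      by metis
    have "\<exists>!x\<in>S. \<Phi> x = x"
    proof (rule Banach_fix)
      show "complete S"
        unfolding S_def complete_eq_closed by (intro closed_PiC) auto
      have "const_bcontfun y0 \<in> S"
        by (auto simp: S_def mem_PiC_iff const_bcontfun.rep_eq)
      then show "S \<noteq> {}" by blast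
      fix x z assume x: "x \<in> S" and z: "z \<in> S"
      show "dist (\<Phi> x) (\<Phi> z) \<le> 3/4 * dist x z"
      proof (rule dist_bound)
        fix t
        define c where "c = clamp (-\<tau>) \<tau> t"
        have c: "c \<in> {-\<tau>..\<tau>}"
          unfolding c_def using clamp_in_interval[of "-\<tau>" \<tau> t] \<tau>(1) by simp
        let ?D = "\<lambda>s. G (x s) - G (z s)"
        have J: "J x c - J z c = integral {-\<tau>..c} ?D - integral {-\<tau>..0} ?D"
          using integral_diff[OF intg[OF x] intg[OF z]] by (simp add: J_def)
        have "norm (J x c - J z c) \<le> 3 * \<tau> * (L * dist x z)"
          unfolding J
        proof (rule bnd[OF _ _ c])
          show "continuous_on {-\<tau>..\<tau>} ?D"
            using continuous_on_diff[OF cont[OF x] cont[OF z]] by simp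
          fix s
          have "dist (G (x s)) (G (z s)) \<le> L * dist (x s) (z s)"
            by (intro lipschitz_onD[OF L] subsetD[OF sub] val x z)
          also have "\<dots> \<le> L * dist x z"
            by (intro mult_left_mono dist_bounded L0)
          finally show "norm (?D s) \<le> L * dist x z"
            by (simp add: dist_norm)
        qed
        also have "\<dots> = 3 * \<tau> * L * dist x z" by simp
        also have "\<dots> \<le> 3/4 * dist x z"
          using \<tau>(3) by (intro mult_right_mono) auto
        finally show "dist (\<Phi> x t) (\<Phi> z t) \<le> 3/4 * dist x z"
          by (simp add: \<Phi>(2) x z dist_norm c_def)
      qed
    qed (use \<Phi>(1) in auto)
    then obtain x where x: "x \<in> S" "\<Phi> x = x" by blast
    have eq: "y0 + J x t = apply_bcontfun x t" if "t \<in> {-\<tau>..\<tau>}" for t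
      using \<Phi>(2)[OF x(1), of t] that by (simp add: x(2))
    show "\<exists>y. y 0 = y0 \<and> (\<forall>t. \<bar>t\<bar> < \<tau> \<longrightarrow> (y has_vector_derivative G (y t)) (at t))"
    proof (intro exI[of _ "\<lambda>t. y0 + J x t"] conjI allI impI)
      show "y0 + J x 0 = y0" by (simp add: J_def)
      fix t assume t: "\<bar>t\<bar> < \<tau>"
      have "(J x has_vector_derivative G (x t)) (at t within {-\<tau>..\<tau>})"
        using t by (intro deriv x) auto
      moreover have "at t within {-\<tau>..\<tau>} = at t"
        using t by (intro at_within_interior) (auto simp: interior_atLeastAtMost_real)
      moreover have e: "y0 + J x t = x t"
        using t by (intro eq) auto
      ultimately show "((\<lambda>t. y0 + J x t) has_vector_derivative G (y0 + J x t)) (at t)"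
        unfolding e by (auto intro!: derivative_eq_intros)
    qed
  qed (use \<tau> in auto)
qed

section \<open>Uniqueness, continuation and maximal solutions\<close>

lemma continuous_on_field: "continuous_on S G"
proof (rule continuous_at_imp_continuous_on, rule ballI)
  fix x :: 'a
  obtain L where L: "L-lipschitz_on (cball 0 (norm x + 1)) G"
    using lipschitz_on_balls by blast
  have "continuous_on (ball 0 (norm x + 1)) G"
    by (rule continuous_on_subset[OF lipschitz_on_continuous_on[OF L] ball_subset_cball])
  then show "isCont G x"
    by (rule continuous_on_interior) simp
qed

text \<open>A Gronwall argument in both time directions. Between \<open>c\<close> and
  \<open>t\<close> both curves stay in one ball, so the squared distance \<phi> satisfies
  \<bar>\<phi>'\<bar> \<le> 2 L \<phi>. Then \<phi> exp (-2 L s) is nonincreasing after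
  \<open>c\<close>, \<phi> exp (2 L s) is nondecreasing before \<open>c\<close>, and \<phi> vanishes
  at \<open>c\<close>.\<close>

lemma solution_unique:
  assumes y: "\<And>t. t \<in> J \<Longrightarrow> (y has_vector_derivative G (y t)) (at t)"
    and z: "\<And>t. t \<in> J \<Longrightarrow> (z has_vector_derivative G (z t)) (at t)"
    and J: "is_interval J" "c \<in> J" "t \<in> J" and eq: "y c = z c"
  shows "y t = z t"
proof -
  have K: "closed_segment c t \<subseteq> J"
    using J by (simp add: closed_segment_subset is_interval_convex)
  have "bounded (y ` closed_segment c t \<union> z ` closed_segment c t)"
    using K y z
    by (intro bounded_Un[THEN iffD2] conjI compact_imp_bounded compact_continuous_image
        continuous_at_imp_continuous_on) (auto intro: has_vector_derivative_continuous)
  then obtain R where R: "\<And>s. s \<in> closed_segment c t \<Longrightarrow> y s \<in> cball 0 R \<and> z s \<in> cball 0 R"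
    unfolding bounded_iff by auto
  obtain L where L: "L-lipschitz_on (cball 0 R) G"
    using lipschitz_on_balls by blast
  define \<phi> where "\<phi> s = inner (y s - z s) (y s - z s)" for s
  define \<phi>' where "\<phi>' s = 2 * inner (y s - z s) (G (y s) - G (z s))" for s
  have \<phi>: "(\<phi> has_real_derivative \<phi>' s) (at s)" if "s \<in> closed_segment c t" for s
    unfolding \<phi>_def \<phi>'_def has_real_derivative_iff_has_vector_derivative
    using y[of s] z[of s] that K
    by (auto intro!: derivative_eq_intros simp: inner_commute has_vector_derivative_def
        algebra_simps fun_eq_iff)
  have bound: "\<bar>\<phi>' s\<bar> \<le> 2 * L * \<phi> s" if "s \<in> closed_segment c t" for s
  proof -
    have "\<bar>inner (y s - z s) (G (y s) - G (z s))\<bar> \<le> norm (y s - z s) * norm (G (y s) - G (z s))"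
      by (rule Cauchy_Schwarz_ineq2)
    also have "\<dots> \<le> norm (y s - z s) * (L * norm (y s - z s))"
      using lipschitz_onD[OF L, of "y s" "z s"] R[OF that]
      by (intro mult_left_mono) (auto simp: dist_norm)
    finally show ?thesis
      by (simp add: \<phi>_def \<phi>'_def abs_mult power2_norm_eq_inner[symmetric] power2_eq_square
          algebra_simps)
  qed
  have "\<phi> t \<le> 0"
  proof (cases "c \<le> t")
    case True
    have "\<phi> t * exp (- (2 * L) * t) \<le> \<phi> c * exp (- (2 * L) * c)"
    proof (rule DERIV_nonpos_imp_nonincreasing[OF True])
      fix s assume "c \<le> s" "s \<le> t"
      then have s: "s \<in> closed_segment c t" using True by (simp add: closed_segment_eq_real_ivl)
      show "\<exists>d. ((\<lambda>s. \<phi> s * exp (- (2 * L) * s)) has_real_derivative d) (at s) \<and> d \<le> 0"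
      proof (intro exI[of _ "(\<phi>' s - 2 * L * \<phi> s) * exp (- (2 * L) * s)"] conjI)
        show "((\<lambda>s. \<phi> s * exp (- (2 * L) * s)) has_real_derivative
            (\<phi>' s - 2 * L * \<phi> s) * exp (- (2 * L) * s)) (at s)"
          by (auto intro!: derivative_eq_intros \<phi>[OF s] simp: algebra_simps)
      qed (use bound[OF s] in \<open>auto intro!: mult_nonpos_nonneg\<close>)
    qed
    then show ?thesis by (simp add: \<phi>_def[of c] eq mult_le_0_iff)
  next
    case False
    then have tc: "t \<le> c" by simp
    have "\<phi> t * exp (2 * L * t) \<le> \<phi> c * exp (2 * L * c)"
    proof (rule DERIV_nonneg_imp_nondecreasing[OF tc])
      fix s assume "t \<le> s" "s \<le> c"
      then have s: "s \<in> closed_segment c t" using tc by (auto simp: closed_segment_eq_real_ivl)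
      show "\<exists>d. ((\<lambda>s. \<phi> s * exp (2 * L * s)) has_real_derivative d) (at s) \<and> 0 \<le> d"
      proof (intro exI[of _ "(\<phi>' s + 2 * L * \<phi> s) * exp (2 * L * s)"] conjI)
        show "((\<lambda>s. \<phi> s * exp (2 * L * s)) has_real_derivative
            (\<phi>' s + 2 * L * \<phi> s) * exp (2 * L * s)) (at s)"
          by (auto intro!: derivative_eq_intros \<phi>[OF s] simp: algebra_simps)
      qed (use bound[OF s] in \<open>auto intro!: mult_nonneg_nonneg\<close>)
    qed
    then show ?thesis by (simp add: \<phi>_def[of c] eq mult_le_0_iff)
  qed
  then show ?thesis
    unfolding \<phi>_def by (metis inner_eq_zero_iff inner_ge_zero order_antisym right_minus_eq)
qed

lemma ode_solution_unique:
  assumes "ode_solution G y0 I y" "ode_solution G y0 J z" "t \<in> I" "t \<in> J"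
  shows "y t = z t"
  by (rule solution_unique[of "I \<inter> J" _ _ 0])
    (use assms in \<open>auto simp: ode_solution_def intro: is_interval_Int\<close>)

text \<open>Since the equation is autonomous, \<open>z\<close> may be shifted to start at
  \<open>t0\<close>. By uniqueness the two curves agree on the overlap, so the glued curve is
  differentiable at every point of the open union.\<close>

lemma ode_solution_extend:
  assumes sol: "ode_solution G y0 I y" and t0: "t0 \<in> I" and eq: "z 0 = y t0"
    and \<tau>: "\<tau> > 0"
    and z: "\<And>t. \<bar>t\<bar> < \<tau> \<Longrightarrow> (z has_vector_derivative G (z t)) (at t)"
  shows "\<exists>w. ode_solution G y0 (I \<union> {t0 - \<tau><..<t0 + \<tau>}) w"
proof -
  let ?K = "{t0 - \<tau><..<t0 + \<tau>}"
  define zt where "zt t = z (t - t0)" for t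
  define w where "w t = (if t \<in> I then y t else zt t)" for t
  have zt: "(zt has_vector_derivative G (zt t)) (at t)" if "t \<in> ?K" for t
  proof -
    have "(z has_vector_derivative G (z (t - t0))) (at (t - t0))"
      using that by (intro z) auto
    then have "((z \<circ> (\<lambda>t. t - t0)) has_vector_derivative 1 *\<^sub>R G (z (t - t0))) (at t)"
      by (intro vector_diff_chain_at) (auto intro!: derivative_eq_intros)
    then show ?thesis
      by (simp add: zt_def[abs_def] o_def)
  qed
  have I: "open I" "is_interval I" "0 \<in> I" "y 0 = y0"
    and y: "\<And>t. t \<in> I \<Longrightarrow> (y has_vector_derivative G (y t)) (at t)"
    using sol by (auto simp: ode_solution_def)
  have eq': "y t0 = zt t0"
    using eq by (simp add: zt_def)
  have agree: "y t = zt t" if "t \<in> I" "t \<in> ?K" for t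
    by (rule solution_unique[of "I \<inter> ?K" _ _ t0])
      (use that y zt I t0 \<tau> eq' in \<open>auto intro!: is_interval_Int is_interval_oo\<close>)
  have "(w has_vector_derivative G (w t)) (at t)" if t: "t \<in> I \<union> ?K" for t
  proof (cases "t \<in> I")
    case True
    have "(w has_vector_derivative G (y t)) (at t)"
      by (rule has_vector_derivative_transform_within_open[OF y[OF True] I(1) True])
        (auto simp: w_def)
    then show ?thesis by (simp add: w_def True)
  next
    case False
    then have tK: "t \<in> ?K" using t by simp
    have "(w has_vector_derivative G (zt t)) (at t)"
      by (rule has_vector_derivative_transform_within_open[OF zt[OF tK] _ tK])
        (auto simp: w_def agree)
    then show ?thesis by (simp add: w_def False)
  qed
  moreover have "is_interval (I \<union> ?K)"
    unfolding is_interval_connected_1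
    by (rule connected_Un) (use I t0 \<tau> in \<open>auto simp: is_interval_connected\<close>)
  ultimately have "ode_solution G y0 (I \<union> ?K) w"
    using I by (auto simp: ode_solution_def w_def)
  then show ?thesis by blast
qed

text \<open>Uniqueness lets all solutions from \<open>y0\<close> be glued on the union of their
  intervals, which is therefore the largest one. The last clause is the blow-up alternative: a norm
  that does not diverge would permit continuation past the end point.\<close>

theorem maximal_ode_solution:
  obtains I y where "ode_solution G y0 I y"
    and "\<And>J z. ode_solution G y0 J z \<Longrightarrow> J \<subseteq> I"
    and "bdd_above I \<Longrightarrow> filterlim (\<lambda>t. norm (y t)) at_top (at_left (Sup I))"
proof -
  define \<J> where "\<J> = {J. \<exists>z. ode_solution G y0 J z}"
  define I where "I = \<Union>\<J>"
  \<comment> \<open>The choice is immaterial, because all solutions defined at \<open>t\<close> have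
    the same value there.\<close>
  define y where "y t = (SOME v. \<exists>J z. ode_solution G y0 J z \<and> t \<in> J \<and> v = z t)" for t
  have y_eq: "y t = z t" if "ode_solution G y0 J z" "t \<in> J" for J z t
    unfolding y_def
    by (rule some_equality) (use that ode_solution_unique in blast)+
  have sub: "J \<subseteq> I" if "ode_solution G y0 J z" for J z
    using that by (auto simp: I_def \<J>_def)
  obtain \<tau> z where \<tau>: "\<tau> > 0" and z: "z 0 = y0"
    "\<And>t. \<bar>t\<bar> < \<tau> \<Longrightarrow> (z has_vector_derivative G (z t)) (at t)"
    using local_solution[of "norm y0"] by blast
  have start: "ode_solution G y0 {-\<tau><..<\<tau>} z"
    using \<tau> z by (auto simp: ode_solution_def is_interval_oo)
  have sol: "ode_solution G y0 I y"
    unfolding ode_solution_def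
  proof (intro conjI ballI)
    show "open I" by (auto simp: I_def \<J>_def ode_solution_def)
    have "connected (\<Union>\<J>)"
      by (rule connected_Union)
        (auto simp: \<J>_def ode_solution_def is_interval_connected)
    then show "is_interval I" by (simp add: I_def is_interval_connected_1)
    show "0 \<in> I" using sub[OF start] \<tau> by auto
    show "y 0 = y0" using y_eq[OF start, of 0] \<tau> z by auto
    fix t assume "t \<in> I"
    then obtain J w where w: "ode_solution G y0 J w" and t: "t \<in> J"
      by (auto simp: I_def \<J>_def)
    have "(y has_vector_derivative G (w t)) (at t)"
      by (rule has_vector_derivative_transform_within_open[of w _ _ J])
        (use w t y_eq[OF w] in \<open>auto simp: ode_solution_def\<close>)
    then show "(y has_vector_derivative G (y t)) (at t)"
      by (simp add: y_eq[OF w t])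
  qed
  have "filterlim (\<lambda>t. norm (y t)) at_top (at_left (Sup I))" if bdd: "bdd_above I"
  proof (rule ccontr)
    define T where "T = Sup I"
    have I: "open I" "is_interval I" "0 \<in> I"
      using sol by (auto simp: ode_solution_def)
    have "T \<notin> I"
    proof
      assume "T \<in> I"
      then obtain e where "e > 0" "cball T e \<subseteq> I"
        using I(1) open_contains_cball by blast
      then have "T + e \<in> I" by (auto simp: dist_norm subset_iff)
      then have "T + e \<le> T" unfolding T_def using bdd by (rule cSup_upper)
      then show False using \<open>e > 0\<close> by simp
    qed
    have "0 \<le> T" unfolding T_def using I(3) bdd by (rule cSup_upper)
    with \<open>T \<notin> I\<close> I(3) have T: "0 < T" by (metis less_eq_real_def)
    have inI: "t \<in> I" if t: "0 \<le> t" "t < T" for t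
    proof -
      obtain s where "s \<in> I" "t < s"
        using t(2) I(3) less_cSupE[of t I] unfolding T_def by blast
      then show ?thesis
        using I(2,3) t(1) mem_is_interval_1_I[of I 0 s t] by simp
    qed
    assume "\<not> filterlim (\<lambda>t. norm (y t)) at_top (at_left (Sup I))"
    then obtain Z where Z: "\<not> (\<forall>\<^sub>F t in at_left T. Z \<le> norm (y t))"
      unfolding filterlim_at_top T_def by blast
    \<comment> \<open>Failure of divergence only gives times arbitrarily close to \<open>T\<close>
      at which the norm is below \<open>Z\<close>. One such time within \<tau> of \<open>T\<close>
      is enough, since \<tau> depends on \<open>Z\<close> but not on that time.\<close>
    obtain \<tau> where \<tau>: "\<tau> > 0" and loc: "\<And>y0. norm y0 \<le> Z \<Longrightarrow>
      \<exists>z. z 0 = y0 \<and> (\<forall>t. \<bar>t\<bar> < \<tau> \<longrightarrow> (z has_vector_derivative G (z t)) (at t))"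
      using local_solution[of Z] by blast
    have "max 0 (T - \<tau>) < T" using T \<tau> by simp
    then have "\<not> (\<forall>t>max 0 (T - \<tau>). t < T \<longrightarrow> Z \<le> norm (y t))"
      using Z unfolding eventually_at_left_field by blast
    then obtain t where "max 0 (T - \<tau>) < t" "t < T" "\<not> Z \<le> norm (y t)"
      by blast
    then have t: "max 0 (T - \<tau>) < t" "t < T" "norm (y t) \<le> Z"
      by simp_all
    obtain z where "z 0 = y t" "\<And>s. \<bar>s\<bar> < \<tau> \<Longrightarrow> (z has_vector_derivative G (z s)) (at s)"
      using loc[OF t(3)] by blast
    then obtain w where "ode_solution G y0 (I \<union> {t - \<tau><..<t + \<tau>}) w"
      using ode_solution_extend[OF sol, of t z \<tau>] inI t \<tau> by auto
    from sub[OF this] have "T \<in> I" using t \<tau> by auto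
    with \<open>T \<notin> I\<close> show False ..
  qed
  from that[OF sol sub this] show ?thesis .
qed

end

section \<open>The operators of the lattice equation\<close>

lemma square_summable_of_bound:
  assumes "\<And>n. \<bar>a n\<bar> \<le> C * \<bar>coord x n\<bar>"
  shows "(\<lambda>n. (a n)\<^sup>2) summable_on UNIV"
proof (rule summable_on_comparison_test)
  show "(\<lambda>n. C\<^sup>2 * (coord x n)\<^sup>2) summable_on UNIV"
    by (intro summable_on_cmult_right coord_square_summable)
  show "(a n)\<^sup>2 \<le> C\<^sup>2 * (coord x n)\<^sup>2" for n
    using power_mono[OF assms[of n], of 2] by (simp add: power_mult_distrib)
qed simp

lemma norm_le_of_coord_bound:
  assumes "\<And>n. \<bar>coord x n\<bar> \<le> C * \<bar>coord y n\<bar>" "0 \<le> C"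
  shows "norm x \<le> C * norm y"
proof (rule norm_le_of_sums)
  fix F :: "'a set" assume F: "finite F"
  have "(\<Sum>n\<in>F. (coord x n)\<^sup>2) \<le> (\<Sum>n\<in>F. C\<^sup>2 * (coord y n)\<^sup>2)"
    using power_mono[OF assms(1), of _ 2] by (intro sum_mono) (simp add: power_mult_distrib)
  also have "\<dots> \<le> C\<^sup>2 * (norm y)\<^sup>2"
    unfolding sum_distrib_left[symmetric] by (intro mult_left_mono sum_coord_square_le F) simp
  finally show "(\<Sum>n\<in>F. (coord x n)\<^sup>2) \<le> (C * norm y)\<^sup>2"
    by (simp add: power_mult_distrib)
qed (use assms(2) in simp)

lemma coord_Abs_ell2:
  "(\<lambda>n. (a n)\<^sup>2) summable_on UNIV \<Longrightarrow> coord (Abs_ell2 a) = a"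
  by (rule Abs_ell2_inverse) simp

lemma has_sum_inner: "((\<lambda>n. coord x n * coord y n) has_sum inner x y) UNIV"
  by (simp add: inner_ell2.rep_eq coord_mult_summable)

lemma has_sum_norm: "((\<lambda>n. (coord x n)\<^sup>2) has_sum (norm x)\<^sup>2) UNIV"
  by (simp add: norm_ell2_square coord_square_summable)

lemma has_sum_sum:
  fixes f :: "'i \<Rightarrow> 'a \<Rightarrow> 'b::topological_comm_monoid_add"
  assumes "\<And>i. i \<in> F \<Longrightarrow> (f i has_sum s i) A"
  shows "((\<lambda>n. \<Sum>i\<in>F. f i n) has_sum (\<Sum>i\<in>F. s i)) A"
  using assms by (induction F rule: infinite_finite_induct) (auto intro: has_sum_add)

lemma has_sum_diff:
  fixes f g :: "'a \<Rightarrow> real"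
  assumes "(f has_sum a) A" "(g has_sum b) A"
  shows "((\<lambda>n. f n - g n) has_sum (a - b)) A"
  using has_sum_add[OF assms(1) has_sum_uminusI[OF assms(2)]] by simp

subsection \<open>Translations\<close>

lift_definition translate :: "'a::ab_group_add \<Rightarrow> 'a ell2 \<Rightarrow> 'a ell2" is
  "\<lambda>k u n. u (n + k)"
  by (subst summable_on_reindex_bij_betw[OF bij_plus_right, of "\<lambda>n. (_ n)\<^sup>2"])

lemmas coord_translate [simp] = translate.rep_eq

text \<open>Reindexing the sum by a shift shows that the adjoint of a translation is the inverse
  translation.\<close>

lemma inner_translate: "inner (translate k x) y = inner x (translate (- k) y)"
proof -
  have "((\<lambda>n. coord x (n + k) * coord (translate (- k) y) (n + k)) has_sum
          inner x (translate (- k) y)) UNIV"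
    using has_sum_inner[of x "translate (- k) y"]
      has_sum_reindex_bij_betw[OF bij_plus_right,
        of "\<lambda>n. coord x n * coord (translate (- k) y) n" k] by simp
  then show ?thesis
    using has_sum_inner[of "translate k x" y] has_sum_unique by fastforce
qed

lemma norm_translate [simp]: "norm (translate k x) = norm x"
proof -
  have "translate (- k) (translate k x) = x"
    by (rule ell2_eqI) simp
  then show ?thesis
    by (simp add: norm_eq_sqrt_inner inner_translate)
qed

lemma bounded_linear_translate: "bounded_linear (translate k)"
  by (rule bounded_linear_intro[of _ 1]) (auto intro: ell2_eqI)

subsection \<open>The power nonlinearity\<close>

text \<open>Away from 0 this is the power rule. At 0, where that rule does not apply, the difference
  quotient is \<bar>h\<bar> to the power \<open>r\<close>, which tends to 0 because \<open>r\<close>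
  is positive.\<close>

lemma has_real_derivative_abs_powr_mult:
  fixes r x :: real
  assumes "r > 0"
  shows "((\<lambda>x. \<bar>x\<bar> powr r * x) has_real_derivative (r + 1) * \<bar>x\<bar> powr r) (at x)"
proof (cases "x = 0")
  case True
  have "((\<lambda>h. \<bar>h\<bar> powr r) \<longlongrightarrow> \<bar>0\<bar> powr r) (at (0::real))"
    using assms by (intro tendsto_powr' tendsto_intros) auto
  moreover have "\<forall>\<^sub>F h in at (0::real). \<bar>h\<bar> powr r = \<bar>h\<bar> powr r * h / h"
    by (auto simp: eventually_at_filter)
  ultimately have "((\<lambda>h. \<bar>h\<bar> powr r * h / h) \<longlongrightarrow> 0) (at (0::real))"
    by (simp add: filterlim_cong)
  then show ?thesis
    using True by (simp add: DERIV_def)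
next
  case False
  have "(abs has_real_derivative sgn x) (at x)"
  proof (cases "x > 0")
    case True
    show ?thesis
      by (rule has_field_derivative_transform_within_open[of "\<lambda>x. x" _ _ "{0<..}"])
        (use True in auto)
  next
    case False
    show ?thesis
      by (rule has_field_derivative_transform_within_open[of "\<lambda>x. - x" _ _ "{..<0}"])
        (use False \<open>x \<noteq> 0\<close> in \<open>auto intro!: derivative_eq_intros\<close>)
  qed
  from DERIV_fun_powr[OF this, of r]
  have "((\<lambda>x. \<bar>x\<bar> powr r) has_real_derivative r * \<bar>x\<bar> powr (r - 1) * sgn x) (at x)"
    using False by simp
  from DERIV_mult[OF this DERIV_ident]
  have "((\<lambda>x. \<bar>x\<bar> powr r * x) has_real_derivative
      r * \<bar>x\<bar> powr (r - 1) * sgn x * x + \<bar>x\<bar> powr r) (at x)"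
    by simp
  also have "r * \<bar>x\<bar> powr (r - 1) * sgn x * x = r * (\<bar>x\<bar> powr (r - 1) * \<bar>x\<bar>)"
    by (simp add: abs_sgn mult.assoc mult.commute[of x])
  also have "\<bar>x\<bar> powr (r - 1) * \<bar>x\<bar> = \<bar>x\<bar> powr r"
    using False by (simp add: powr_diff)
  finally show ?thesis by (simp add: algebra_simps)
qed

lemma abs_powr_mult_lipschitz:
  fixes r a b R :: real
  assumes "r > 0" "\<bar>a\<bar> \<le> R" "\<bar>b\<bar> \<le> R"
  shows "\<bar>\<bar>a\<bar> powr r * a - \<bar>b\<bar> powr r * b\<bar> \<le> (r + 1) * R powr r * \<bar>a - b\<bar>"
proof -
  have "norm (\<bar>a\<bar> powr r * a - \<bar>b\<bar> powr r * b) \<le> (r + 1) * R powr r * norm (a - b)"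
  proof (rule field_differentiable_bound[of "{-R..R}" _ "\<lambda>x. (r + 1) * \<bar>x\<bar> powr r"])
    fix z assume z: "z \<in> {-R..R}"
    show "((\<lambda>x. \<bar>x\<bar> powr r * x) has_real_derivative (r + 1) * \<bar>z\<bar> powr r) (at z within {-R..R})"
      by (rule has_field_derivative_at_within[OF has_real_derivative_abs_powr_mult[OF assms(1)]])
    show "norm ((r + 1) * \<bar>z\<bar> powr r) \<le> (r + 1) * R powr r"
      using z assms(1) by (auto simp: abs_mult intro!: mult_left_mono powr_mono2)
  qed (use assms in auto)
  then show ?thesis by simp
qed

text \<open>The product \<open>\<bar>a\<bar> powr r * a * a\<close> is \<open>\<bar>a\<bar> powr (r + 2)\<close>, with derivative
  \<open>(r + 2) * (\<bar>a\<bar> powr r * a)\<close>; since that derivative is locally Lipschitz, the Taylor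
  remainder is quadratic.\<close>

lemma abs_powr_remainder:
  fixes r a b R :: real
  assumes r: "r > 0" and ab: "\<bar>a\<bar> \<le> R" "\<bar>b\<bar> \<le> R"
  defines "N \<equiv> \<lambda>x::real. \<bar>x\<bar> powr r * x"
  shows "\<bar>N b * b - N a * a - (r + 2) * (N a * (b - a))\<bar>
           \<le> (r + 2) * ((r + 1) * R powr r) * (b - a)\<^sup>2"
proof -
  define L where "L = (r + 1) * R powr r"
  have L: "L \<ge> 0" using r by (simp add: L_def)
  let ?S = "closed_segment a b"
  have "norm ((N b * b - (r + 2) * N a * b) - (N a * a - (r + 2) * N a * a))
          \<le> ((r + 2) * (L * \<bar>b - a\<bar>)) * norm (b - a)"
  proof (rule field_differentiable_bound[of ?S _ "\<lambda>x. (r + 2) * N x - (r + 2) * N a"])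
    fix z assume z: "z \<in> ?S"
    have "(N has_real_derivative (r + 1) * \<bar>z\<bar> powr r) (at z)"
      unfolding N_def by (rule has_real_derivative_abs_powr_mult[OF r])
    from DERIV_diff[OF DERIV_mult[OF this DERIV_ident] DERIV_cmult[OF DERIV_ident, of "(r + 2) * N a"]]
    have "((\<lambda>x. N x * x - (r + 2) * N a * x) has_real_derivative (r + 2) * N z - (r + 2) * N a) (at z)"
      by (simp add: N_def algebra_simps)
    then show "((\<lambda>x. N x * x - (r + 2) * N a * x) has_real_derivative
        (r + 2) * N z - (r + 2) * N a) (at z within ?S)"
      by (rule has_field_derivative_at_within)
    have zR: "\<bar>z\<bar> \<le> R" and za: "\<bar>z - a\<bar> \<le> \<bar>b - a\<bar>"
      using z ab by (auto simp: closed_segment_eq_real_ivl split: if_splits)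
    have "\<bar>N z - N a\<bar> \<le> L * \<bar>z - a\<bar>"
      unfolding N_def L_def by (rule abs_powr_mult_lipschitz[OF r zR ab(1)])
    also have "\<dots> \<le> L * \<bar>b - a\<bar>" using za L by (rule mult_left_mono)
    finally have "(r + 2) * \<bar>N z - N a\<bar> \<le> (r + 2) * (L * \<bar>b - a\<bar>)"
      using r by (intro mult_left_mono) auto
    moreover have "norm ((r + 2) * N z - (r + 2) * N a) = (r + 2) * \<bar>N z - N a\<bar>"
      using r by (simp add: right_diff_distrib[symmetric] abs_mult)
    ultimately show "norm ((r + 2) * N z - (r + 2) * N a) \<le> (r + 2) * (L * \<bar>b - a\<bar>)"
      by simp
  qed auto
  then show ?thesis
    by (simp add: L_def power2_eq_square algebra_simps)
qed

text \<open>The nonlinear term of the equation is the case r = 2 \<sigma>. \<open>Abs_ell2\<close>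
  is meaningful on square summable families only, which \<open>coord_nonlin\<close> checks for
  positive \<open>r\<close>.\<close>

definition nonlin :: "real \<Rightarrow> 'a ell2 \<Rightarrow> 'a ell2" where
  "nonlin r x = Abs_ell2 (\<lambda>n. \<bar>coord x n\<bar> powr r * coord x n)"

context
  fixes r :: real
  assumes r: "r > 0"
begin

lemma coord_nonlin: "coord (nonlin r x) n = \<bar>coord x n\<bar> powr r * coord x n"
proof -
  have "(\<lambda>n. (\<bar>coord x n\<bar> powr r * coord x n)\<^sup>2) summable_on UNIV"
  proof (rule square_summable_of_bound)
    fix n
    show "\<bar>\<bar>coord x n\<bar> powr r * coord x n\<bar> \<le> norm x powr r * \<bar>coord x n\<bar>"
      using r by (simp add: abs_mult mult_right_mono powr_mono2 abs_coord_le_norm)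
  qed
  then show ?thesis
    by (simp add: nonlin_def coord_Abs_ell2)
qed

lemma nonlin_lipschitz_on_ball:
  assumes "0 \<le> R"
  shows "((r + 1) * R powr r)-lipschitz_on (cball 0 R) (nonlin r :: 'a ell2 \<Rightarrow> _)"
proof (rule lipschitz_onI)
  fix x y :: "'a ell2" assume xy: "x \<in> cball 0 R" "y \<in> cball 0 R"
  have "norm (nonlin r x - nonlin r y) \<le> (r + 1) * R powr r * norm (x - y)"
  proof (rule norm_le_of_coord_bound)
    fix n
    have "\<bar>coord x n\<bar> \<le> R" "\<bar>coord y n\<bar> \<le> R"
      using xy abs_coord_le_norm[of x n] abs_coord_le_norm[of y n] by auto
    then show "\<bar>coord (nonlin r x - nonlin r y) n\<bar> \<le> (r + 1) * R powr r * \<bar>coord (x - y) n\<bar>"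
      using abs_powr_mult_lipschitz[OF r] by (simp add: coord_nonlin)
  qed (use r in simp)
  then show "dist (nonlin r x) (nonlin r y) \<le> (r + 1) * R powr r * dist x y"
    by (simp add: dist_norm)
qed (use r in simp)

lemma has_sum_potential:
  "((\<lambda>n. \<bar>coord x n\<bar> powr (r + 2)) has_sum inner (nonlin r x) x) UNIV"
proof -
  have "\<bar>a\<bar> powr (r + 2) = \<bar>a\<bar> powr r * a * a" for a :: real
    by (cases "a = 0") (auto simp: powr_add power2_eq_square)
  then show ?thesis
    using has_sum_inner[of "nonlin r x" x] by (simp add: coord_nonlin)
qed

text \<open>All coordinates of \<open>x\<close>, and of every \<open>y\<close> within distance 1,
  are bounded by \<open>R\<close>. The sitewise Taylor remainders therefore have one constant
  \<open>C\<close>, and their sum is at most \<open>C\<close> times the squared norm of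
  \<open>y - x\<close>. Thus \<open>nonlin\<close> is a multiple of the gradient of the potential,
  which is what conserves the energy.\<close>

lemma potential_has_derivative:
  "((\<lambda>x. inner (nonlin r x) x) has_derivative (\<lambda>w. (r + 2) * inner (nonlin r x) w)) (at x)"
proof -
  define R where "R = norm x + 1"
  define C where "C = (r + 2) * ((r + 1) * R powr r)"
  have main: "\<bar>inner (nonlin r y) y - inner (nonlin r x) x - (r + 2) * inner (nonlin r x) (y - x)\<bar>
      \<le> C * (norm (y - x))\<^sup>2" if y: "dist y x < 1" for y
  proof -
    have "norm y \<le> R"
      using y norm_triangle_sub[of y x] by (simp add: R_def dist_norm)
    then have bd: "\<bar>coord x n\<bar> \<le> R" "\<bar>coord y n\<bar> \<le> R" for n
      using abs_coord_le_norm[of x n] abs_coord_le_norm[of y n] by (auto simp: R_def)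
    have s: "((\<lambda>n. coord (nonlin r y) n * coord y n - coord (nonlin r x) n * coord x n
        - (r + 2) * (coord (nonlin r x) n * coord (y - x) n)) has_sum
        (inner (nonlin r y) y - inner (nonlin r x) x - (r + 2) * inner (nonlin r x) (y - x))) UNIV"
      by (intro has_sum_diff has_sum_cmult_right has_sum_inner)
    have t: "((\<lambda>n. C * (coord (y - x) n)\<^sup>2) has_sum C * (norm (y - x))\<^sup>2) UNIV"
      by (intro has_sum_cmult_right has_sum_norm)
    have le: "\<bar>coord (nonlin r y) n * coord y n - coord (nonlin r x) n * coord x n
        - (r + 2) * (coord (nonlin r x) n * coord (y - x) n)\<bar> \<le> C * (coord (y - x) n)\<^sup>2" for n
      using abs_powr_remainder[OF r bd(1) bd(2), of n n] by (simp add: coord_nonlin C_def)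
    have "inner (nonlin r y) y - inner (nonlin r x) x - (r + 2) * inner (nonlin r x) (y - x)
        \<le> C * (norm (y - x))\<^sup>2"
      by (rule has_sum_mono[OF s t]) (use le abs_le_D1 in blast)
    moreover have "- (inner (nonlin r y) y - inner (nonlin r x) x - (r + 2) * inner (nonlin r x) (y - x))
        \<le> C * (norm (y - x))\<^sup>2"
      by (rule has_sum_mono[OF has_sum_uminusI[OF s] t]) (use le abs_le_D2 in blast)
    ultimately show ?thesis by (rule abs_leI)
  qed
  show ?thesis
  proof (rule has_derivativeI_sandwich[of 1 _ UNIV])
    show "bounded_linear (\<lambda>w. (r + 2) * inner (nonlin r x) w)"
      by (intro bounded_linear_intros bounded_linear_const_mult bounded_linear_inner_right)
    show "((\<lambda>y. C * norm (y - x)) \<longlongrightarrow> 0) (at x)"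
      by (rule tendsto_eq_intros refl | simp)+
    fix y assume "y \<noteq> x" "dist y x < 1"
    then show "norm (inner (nonlin r y) y - inner (nonlin r x) x - (r + 2) * inner (nonlin r x) (y - x))
        / norm (y - x) \<le> C * norm (y - x)"
      using main[of y] by (simp add: field_simps power2_eq_square)
  qed simp
qed

text \<open>All but two of the factors at each site are bounded through the sup norm. This will
  control the velocity by the norm of \<open>u\<close> alone.\<close>

lemma potential_le: "inner (nonlin r x) x \<le> norm x powr r * (norm x)\<^sup>2"
proof (rule has_sum_mono[OF has_sum_inner has_sum_cmult_right[OF has_sum_norm]])
  fix n
  have "\<bar>coord x n\<bar> powr r * (coord x n)\<^sup>2 \<le> norm x powr r * (coord x n)\<^sup>2"
    using r by (intro mult_right_mono powr_mono2 abs_coord_le_norm) auto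
  then show "coord (nonlin r x) n * coord x n \<le> norm x powr r * (coord x n)\<^sup>2"
    by (simp add: coord_nonlin power2_eq_square mult.assoc)
qed

end

subsection \<open>The discrete Klein-Gordon operator\<close>

definition multiplier :: "('a \<Rightarrow> real) \<Rightarrow> 'a ell2 \<Rightarrow> 'a ell2" where
  "multiplier V x = Abs_ell2 (\<lambda>n. V n * coord x n)"

locale lattice_nlkg =
  fixes h \<sigma> :: real and V :: "int ^ 'd::finite \<Rightarrow> real"
  assumes h: "h > 0" and \<sigma>: "\<sigma> > 0"
    and V_bounded: "bounded (range V)" and V_nonneg: "\<And>n. 0 \<le> V n"
begin

lemma coord_multiplier: "coord (multiplier V x) n = V n * coord x n"
proof -
  obtain B where "\<And>n. \<bar>V n\<bar> \<le> B"
    using V_bounded unfolding bounded_iff by auto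
  then have "(\<lambda>n. (V n * coord x n)\<^sup>2) summable_on UNIV"
    by (intro square_summable_of_bound[where C = B and x = x]) (simp add: abs_mult mult_right_mono)
  then show ?thesis
    by (simp add: multiplier_def coord_Abs_ell2)
qed

lemma bounded_linear_multiplier: "bounded_linear (multiplier V)"
proof -
  obtain B where B: "\<And>n. \<bar>V n\<bar> \<le> B"
    using V_bounded unfolding bounded_iff by auto
  then have "0 \<le> B" using abs_ge_zero order_trans by blast
  show ?thesis
  proof (rule bounded_linear_intro[of _ B])
    show "norm (multiplier V x) \<le> norm x * B" for x
      unfolding mult.commute[of _ B] using \<open>0 \<le> B\<close> B
      by (intro norm_le_of_coord_bound) (auto simp: coord_multiplier abs_mult mult_right_mono)
  qed (auto intro!: ell2_eqI simp: coord_multiplier algebra_simps)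
qed

text \<open>The operator -\<Delta> + V, built from translations so that boundedness and symmetry are
  inherited term by term.\<close>

definition linop :: "(int ^ 'd) ell2 \<Rightarrow> (int ^ 'd) ell2" where
  "linop x = (1 / h\<^sup>2) *\<^sub>R
      (\<Sum>j\<in>UNIV. 2 *\<^sub>R x - translate (axis j 1) x - translate (- axis j 1) x) + multiplier V x"

lemma bounded_linear_linop: "bounded_linear linop"
  unfolding linop_def[abs_def]
  by (intro bounded_linear_add bounded_linear_const_scaleR bounded_linear_sum bounded_linear_sub
      bounded_linear_scaleR_right bounded_linear_translate bounded_linear_multiplier)

lemma coord_linop: "coord (linop x) n = V n * coord x n - discrete_laplacian h (coord x) n"
proof -
  have "coord (\<Sum>j\<in>A. f j) n = (\<Sum>j\<in>A. coord (f j) n)"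
    for f :: "'d \<Rightarrow> (int ^ 'd) ell2" and A
    by (rule linear_sum[OF bounded_linear.linear[OF bounded_linear_coord]])
  then have "coord (linop x) n =
      (\<Sum>j\<in>UNIV. 1 / h\<^sup>2 * (2 * coord x n - coord x (n + axis j 1) - coord x (n - axis j 1)))
        + V n * coord x n"
    by (simp add: linop_def coord_multiplier sum_divide_distrib)
  also have "(\<Sum>j\<in>UNIV. 1 / h\<^sup>2 * (2 * coord x n - coord x (n + axis j 1) - coord x (n - axis j 1)))
      = (\<Sum>j\<in>UNIV. - ((coord x (n + axis j 1) + coord x (n - axis j 1) - 2 * coord x n) / h\<^sup>2))"
    by (intro sum.cong) (simp_all add: diff_divide_distrib add_divide_distrib)
  finally show ?thesis
    by (simp add: discrete_laplacian_def sum_negf)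
qed

lemma inner_multiplier: "inner (multiplier V x) y = inner x (multiplier V y)"
  by (simp add: inner_ell2.rep_eq coord_multiplier mult_ac)

lemma linop_symmetric: "inner (linop x) y = inner x (linop y)"
proof -
  have "inner (translate (axis j 1) x) y + inner (translate (- axis j 1) x) y
      = inner x (translate (axis j 1) y) + inner x (translate (- axis j 1) y)" for j
    using inner_translate[of "axis j 1" x y] inner_translate[of "- axis j 1" x y] by simp
  then show ?thesis
    by (simp add: linop_def inner_add_left inner_add_right inner_sum_left inner_sum_right
        inner_diff_left inner_diff_right inner_multiplier diff_diff_eq)
qed

text \<open>Summation by parts. Translations are isometries, so expanding the squared norm of
  \<open>translate k x - x\<close> gives exactly the pairing of \<open>x\<close> with its second
  difference, up to sign.\<close>

lemma has_sum_quadratic_form: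
  "((\<lambda>n. 1 / h\<^sup>2 * (\<Sum>j\<in>UNIV. (coord x (n + axis j 1) - coord x n)\<^sup>2) + V n * \<bar>coord x n\<bar>\<^sup>2)
      has_sum inner (linop x) x) UNIV"
proof -
  have "inner (2 *\<^sub>R x - translate k x - translate (- k) x) x = (norm (translate k x - x))\<^sup>2" for k
  proof -
    have "inner (translate k x) (translate k x) = inner x x"
      by (metis norm_translate power2_norm_eq_inner)
    then show ?thesis
      unfolding power2_norm_eq_inner using inner_translate[of k x x]
      by (simp add: inner_diff_left inner_diff_right inner_commute)
  qed
  then have "inner (linop x) x =
      1 / h\<^sup>2 * (\<Sum>j\<in>UNIV. (norm (translate (axis j 1) x - x))\<^sup>2) + inner (multiplier V x) x"
    by (simp add: linop_def inner_add_left inner_sum_left)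
  moreover have "((\<lambda>n. 1 / h\<^sup>2 * (\<Sum>j\<in>UNIV. (coord (translate (axis j 1) x - x) n)\<^sup>2)
      + coord (multiplier V x) n * coord x n) has_sum
      1 / h\<^sup>2 * (\<Sum>j\<in>UNIV. (norm (translate (axis j 1) x - x))\<^sup>2) + inner (multiplier V x) x) UNIV"
    by (intro has_sum_add has_sum_cmult_right has_sum_sum has_sum_norm has_sum_inner)
  ultimately show ?thesis
    by (simp add: coord_multiplier power2_eq_square mult.assoc)
qed

lemma quadratic_form_nonneg: "0 \<le> inner (linop x) x"
  by (rule has_sum_nonneg[OF has_sum_quadratic_form])
    (simp add: V_nonneg sum_nonneg)

text \<open>The energy as a function on phase space, expressed by inner products so that it can be
  differentiated along a curve; \<open>energy_eq_total_energy\<close> identifies it with the lattice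
  sum.\<close>

definition total_energy :: "(int ^ 'd) ell2 \<times> (int ^ 'd) ell2 \<Rightarrow> real" where
  "total_energy p = 1/2 * (inner (snd p) (snd p) + inner (linop (fst p)) (fst p)
      - 1 / (\<sigma> + 1) * inner (nonlin (2 * \<sigma>) (fst p)) (fst p))"

lemma energy_eq_total_energy: "energy h \<sigma> V (coord x) (coord v) = total_energy (x, v)"
proof -
  have r: "2 * \<sigma> > 0" using \<sigma> by simp
  have "((\<lambda>n. (coord v n)\<^sup>2 + (1 / h\<^sup>2 * (\<Sum>j\<in>UNIV. (coord x (n + axis j 1) - coord x n)\<^sup>2)
        + V n * \<bar>coord x n\<bar>\<^sup>2) - 1 / (\<sigma> + 1) * \<bar>coord x n\<bar> powr (2 * \<sigma> + 2)) has_sum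
      (norm v)\<^sup>2 + inner (linop x) x - 1 / (\<sigma> + 1) * inner (nonlin (2 * \<sigma>) x) x) UNIV"
    by (intro has_sum_add has_sum_diff has_sum_cmult_right has_sum_norm has_sum_quadratic_form
        has_sum_potential r)
  from infsumI[OF this] show ?thesis
    by (simp add: energy_def total_energy_def power2_norm_eq_inner add.assoc)
qed

subsection \<open>The evolution equation in phase space\<close>

definition field ::
  "(int ^ 'd) ell2 \<times> (int ^ 'd) ell2 \<Rightarrow> (int ^ 'd) ell2 \<times> (int ^ 'd) ell2" where
  "field p = (snd p, nonlin (2 * \<sigma>) (fst p) - linop (fst p))"

sublocale lipschitz_field field
proof
  fix R
  show "\<exists>L. L-lipschitz_on (cball 0 R) field"
  proof (cases "R < 0")
    case True
    then show ?thesis by (intro exI[of _ 0]) simp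
  next
    case False
    have r: "2 * \<sigma> > 0" using \<sigma> by simp
    obtain A where A: "A-lipschitz_on (cball 0 R) (\<lambda>p :: (int ^ 'd) ell2 \<times> (int ^ 'd) ell2. snd p)"
      by (rule bounded_linear.lipschitz_boundE[OF bounded_linear_snd, where A = "cball 0 R"]) (erule that)
    obtain B where B: "B-lipschitz_on (cball 0 R) (\<lambda>p :: (int ^ 'd) ell2 \<times> (int ^ 'd) ell2. linop (fst p))"
      by (rule bounded_linear.lipschitz_boundE[OF
            bounded_linear_compose[OF bounded_linear_linop bounded_linear_fst], where A = "cball 0 R"]) (erule that)
    obtain C where C: "C-lipschitz_on (cball 0 R) (\<lambda>p :: (int ^ 'd) ell2 \<times> (int ^ 'd) ell2. fst p)"
      by (rule bounded_linear.lipschitz_boundE[OF bounded_linear_fst, where A = "cball 0 R"]) (erule that)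
    have img: "fst ` cball (0 :: (int ^ 'd) ell2 \<times> (int ^ 'd) ell2) R \<subseteq> cball 0 R"
    proof safe
      fix x v :: "(int ^ 'd) ell2" assume "(x, v) \<in> cball 0 R"
      then show "fst (x, v) \<in> cball 0 R"
        using norm_fst_le[of x v] by simp
    qed
    obtain D where D: "D-lipschitz_on (fst ` cball (0 :: (int ^ 'd) ell2 \<times> (int ^ 'd) ell2) R)
        (nonlin (2 * \<sigma>))"
      using lipschitz_on_subset[OF nonlin_lipschitz_on_ball[OF r, of R] img] False by auto
    show ?thesis
      unfolding field_def[abs_def]
      using lipschitz_on_Pair[OF A lipschitz_on_diff[OF lipschitz_on_compose2[OF C D] B]]
      by blast
  qed
qed

end

subsection \<open>Lattice solutions as curves in phase space\<close>

lemma l2_iff: "u \<in> l2 \<longleftrightarrow> (\<lambda>n. (u n)\<^sup>2) summable_on UNIV"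
  by (simp add: l2_def)

lemma coord_in_l2: "coord x \<in> l2"
  by (simp add: l2_iff coord_square_summable)

lemma coord_Abs_ell2_l2: "u \<in> l2 \<Longrightarrow> coord (Abs_ell2 u) = u"
  by (simp add: l2_iff coord_Abs_ell2)

lemma l2_norm_coord: "l2_norm (coord x) = norm x"
  by (simp add: l2_norm_def norm_ell2_square[symmetric])

lemma l2_continuous_on_iff:
  assumes "\<And>t. t \<in> I \<Longrightarrow> u t = coord (x t)"
  shows "l2_continuous_on I u \<longleftrightarrow> continuous_on I x"
proof -
  have "((\<lambda>s. l2_norm (\<lambda>n. u s n - u t n)) \<longlongrightarrow> 0) (at t within I) \<longleftrightarrow>
      (x \<longlongrightarrow> x t) (at t within I)" if t: "t \<in> I" for t
  proof -
    have "\<forall>\<^sub>F s in at t within I. l2_norm (\<lambda>n. u s n - u t n) = norm (x s - x t)"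
    proof (rule eventually_at_topological[THEN iffD2], intro exI[of _ UNIV] conjI ballI impI)
      fix s assume "s \<in> I"
      then have "(\<lambda>n. u s n - u t n) = coord (x s - x t)"
        using assms t by auto
      then show "l2_norm (\<lambda>n. u s n - u t n) = norm (x s - x t)"
        by (simp only: l2_norm_coord)
    qed auto
    then have "((\<lambda>s. l2_norm (\<lambda>n. u s n - u t n)) \<longlongrightarrow> 0) (at t within I) \<longleftrightarrow>
        ((\<lambda>s. norm (x s - x t)) \<longlongrightarrow> 0) (at t within I)"
      by (rule tendsto_cong)
    then show ?thesis
      by (simp add: tendsto_norm_zero_iff Lim_null[of x])
  qed
  then show ?thesis
    using assms by (simp add: l2_continuous_on_def continuous_on_def coord_in_l2)
qed

text \<open>Sitewise derivatives carry no uniformity in the site, but continuity of the candidate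
  derivative lets one compare \<open>a\<close> with the Hilbert space integral of \<open>b\<close>.\<close>

lemma ell2_has_vector_derivative:
  assumes J: "open J" "t \<in> J" and b: "continuous_on J b"
    and a: "\<And>t n. t \<in> J \<Longrightarrow> ((\<lambda>s. coord (a s) n) has_real_derivative coord (b t) n) (at t)"
  shows "(a has_vector_derivative b t) (at t)"
proof -
  obtain e where e: "e > 0" "cball t e \<subseteq> J"
    using J open_contains_cball by blast
  define K where "K = {t - e..t + e}"
  have K: "K \<subseteq> J" "t \<in> K" using e by (auto simp: K_def cball_eq_atLeastAtMost)
  define F where "F s = integral {t - e..s} b" for s
  have F: "(F has_vector_derivative b s) (at s within K)" if "s \<in> K" for s
    unfolding F_def[abs_def] K_def
    using that K by (intro integral_has_vector_derivative continuous_on_subset[OF b]) (auto simp: K_def)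
  \<comment> \<open>Each coordinate of \<open>F - a\<close> has zero derivative on \<open>K\<close>,
    so \<open>a\<close> differs from the primitive \<open>F\<close> by a fixed vector and inherits
    its derivative in norm.\<close>
  have "coord (F s - a s) n = coord (F t - a t) n" if s: "s \<in> K" for s n
  proof -
    have "((\<lambda>s. coord (F s) n - coord (a s) n) has_real_derivative 0) (at s within K)"
      if s: "s \<in> K" for s
    proof -
      have "((\<lambda>s. coord (F s) n) has_real_derivative coord (b s) n) (at s within K)"
        unfolding has_real_derivative_iff_has_vector_derivative
        by (rule bounded_linear.has_vector_derivative[OF bounded_linear_coord F[OF s]])
      moreover have "((\<lambda>s. coord (a s) n) has_real_derivative coord (b s) n) (at s within K)"
        using a[of s n] s K by (auto intro: has_field_derivative_at_within)
      ultimately show ?thesis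
        using DERIV_diff by fastforce
    qed
    then have "\<exists>c. \<forall>s\<in>K. coord (F s) n - coord (a s) n = c"
      by (intro has_field_derivative_zero_constant) (auto simp: K_def)
    then obtain c where "\<And>s. s \<in> K \<Longrightarrow> coord (F s) n - coord (a s) n = c"
      by blast
    then show ?thesis using s K by simp
  qed
  then have eq: "F s - (F t - a t) = a s" if "s \<in> K" for s
    using that by (intro ell2_eqI) (simp add: algebra_simps)
  have "(F has_vector_derivative b t) (at t)"
    using F[OF K(2)] e at_within_interior[of t K] by (simp add: K_def)
  then have "((\<lambda>s. F s - (F t - a t)) has_vector_derivative b t) (at t)"
    by (auto intro!: derivative_eq_intros)
  then show ?thesis
    by (rule has_vector_derivative_transform_within_open[of _ _ _ "{t - e<..<t + e}"])
      (use e eq in \<open>auto simp: K_def\<close>)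
qed

context lattice_nlkg
begin

lemma coord_acceleration:
  "coord (nonlin (2 * \<sigma>) x - linop x) n =
     discrete_laplacian h (coord x) n - V n * coord x n + \<bar>coord x n\<bar> powr (2 * \<sigma>) * coord x n"
  using \<sigma> by (simp add: coord_nonlin coord_linop)

text \<open>Through this direction the uniqueness and maximality of curves in phase space apply to
  every competing lattice solution.\<close>

lemma nlkg_imp_ode_solution:
  assumes sol: "nlkg_solution h \<sigma> V f g J w"
  shows "ode_solution field (Abs_ell2 f, Abs_ell2 g) J
           (\<lambda>t. (Abs_ell2 (w t), Abs_ell2 (time_deriv w t)))"
proof -
  define a where "a t = Abs_ell2 (w t)" for t
  define b where "b t = Abs_ell2 (time_deriv w t)" for t
  define c where "c t = nonlin (2 * \<sigma>) (a t) - linop (a t)" for t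
  have J: "open J" "is_interval J" "0 \<in> J"
    and w: "\<And>t. t \<in> J \<Longrightarrow> w t \<in> l2" "\<And>t. t \<in> J \<Longrightarrow> time_deriv w t \<in> l2"
    and lc: "l2_continuous_on J w" "l2_continuous_on J (time_deriv w)"
    and diff: "\<And>t n. t \<in> J \<Longrightarrow> (\<lambda>s. w s n) differentiable (at t)"
      "\<And>t n. t \<in> J \<Longrightarrow> (\<lambda>s. time_deriv w s n) differentiable (at t)"
    and eqn: "\<And>t n. t \<in> J \<Longrightarrow> time_deriv (time_deriv w) t n - discrete_laplacian h (w t) n
        + V n * w t n - \<bar>w t n\<bar> powr (2 * \<sigma>) * w t n = 0"
    and ini: "w 0 = f" "time_deriv w 0 = g"
    using sol by (auto simp: nlkg_solution_def l2_continuous_on_def)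
  have a: "w t = coord (a t)" and b: "time_deriv w t = coord (b t)" if "t \<in> J" for t
    using w[OF that] by (simp_all add: a_def b_def coord_Abs_ell2_l2)
  have ca: "continuous_on J a" and cb: "continuous_on J b"
    using lc l2_continuous_on_iff[of J w a] l2_continuous_on_iff[of J "time_deriv w" b] a b by auto
  \<comment> \<open>A lattice solution is not assumed to have a continuous second derivative;
    continuity of \<open>c\<close> comes from the equation, as the second component of the
    continuous \<open>field\<close>.\<close>
  have "continuous_on J (\<lambda>t. snd (field (a t, b t)))"
    by (intro continuous_on_snd continuous_on_compose2[OF continuous_on_field[of UNIV]]
        continuous_on_Pair ca cb) auto
  then have cc: "continuous_on J c" by (simp add: field_def c_def[abs_def])
  have ab: "((\<lambda>s. coord (a s) n) has_real_derivative coord (b t) n) (at t)" if t: "t \<in> J" for t n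
  proof (rule has_field_derivative_transform_within_open[OF _ J(1) t])
    have "((\<lambda>s. w s n) has_real_derivative time_deriv w t n) (at t)"
      unfolding time_deriv_def using diff(1)[OF t] by (simp add: DERIV_deriv_iff_real_differentiable)
    then show "((\<lambda>s. w s n) has_real_derivative coord (b t) n) (at t)"
      by (simp add: b[OF t])
  qed (simp add: a)
  have bc: "((\<lambda>s. coord (b s) n) has_real_derivative coord (c t) n) (at t)" if t: "t \<in> J" for t n
  proof (rule has_field_derivative_transform_within_open[OF _ J(1) t])
    have "((\<lambda>s. time_deriv w s n) has_real_derivative time_deriv (time_deriv w) t n) (at t)"
      unfolding time_deriv_def[of "time_deriv w"] using diff(2)[OF t]
      by (simp add: DERIV_deriv_iff_real_differentiable)
    moreover have "time_deriv (time_deriv w) t n = coord (c t) n"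
      using eqn[OF t, of n] unfolding c_def coord_acceleration a[OF t, symmetric] by simp
    ultimately show "((\<lambda>s. time_deriv w s n) has_real_derivative coord (c t) n) (at t)"
      by simp
  qed (simp add: b)
  have "((\<lambda>t. (a t, b t)) has_vector_derivative field (a t, b t)) (at t)" if t: "t \<in> J" for t
    using ell2_has_vector_derivative[OF J(1) t cb ab] ell2_has_vector_derivative[OF J(1) t cc bc]
    by (auto simp: field_def c_def intro: has_vector_derivative_Pair)
  then show ?thesis
    using J ini by (simp add: ode_solution_def a_def b_def)
qed

lemma
  assumes sol: "ode_solution field (Abs_ell2 f, Abs_ell2 g) I y" and t: "t \<in> I"
  shows fst_has_vector_derivative: "((\<lambda>s. fst (y s)) has_vector_derivative snd (y t)) (at t)"
    and snd_has_vector_derivative: "((\<lambda>s. snd (y s)) has_vector_derivative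
          nonlin (2 * \<sigma>) (fst (y t)) - linop (fst (y t))) (at t)"
    and time_deriv_coord: "time_deriv (\<lambda>s. coord (fst (y s))) t = coord (snd (y t))"
proof -
  have y: "(y has_vector_derivative field (y t)) (at t)"
    using sol t by (simp add: ode_solution_def)
  show 1: "((\<lambda>s. fst (y s)) has_vector_derivative snd (y t)) (at t)"
    using bounded_linear.has_vector_derivative[OF bounded_linear_fst y] by (simp add: field_def)
  show "((\<lambda>s. snd (y s)) has_vector_derivative
          nonlin (2 * \<sigma>) (fst (y t)) - linop (fst (y t))) (at t)"
    using bounded_linear.has_vector_derivative[OF bounded_linear_snd y] by (simp add: field_def)
  show "time_deriv (\<lambda>s. coord (fst (y s))) t = coord (snd (y t))"
  proof
    fix n
    show "time_deriv (\<lambda>s. coord (fst (y s))) t n = coord (snd (y t)) n"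
      unfolding time_deriv_def
      by (rule DERIV_imp_deriv)
        (use bounded_linear.has_vector_derivative[OF bounded_linear_coord 1] in
          \<open>simp add: has_real_derivative_iff_has_vector_derivative\<close>)
  qed
qed

lemma ode_imp_nlkg_solution:
  assumes fg: "f \<in> l2" "g \<in> l2"
    and sol: "ode_solution field (Abs_ell2 f, Abs_ell2 g) I y"
  shows "nlkg_solution h \<sigma> V f g I (\<lambda>t. coord (fst (y t)))"
proof -
  let ?u = "\<lambda>t. coord (fst (y t))"
  have I: "open I" "is_interval I" "0 \<in> I" "y 0 = (Abs_ell2 f, Abs_ell2 g)"
    using sol by (auto simp: ode_solution_def)
  note td = time_deriv_coord[OF sol]
  have dx: "((\<lambda>s. ?u s n) has_real_derivative coord (snd (y t)) n) (at t)" if "t \<in> I" for t n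
    unfolding has_real_derivative_iff_has_vector_derivative
    by (rule bounded_linear.has_vector_derivative[OF bounded_linear_coord fst_has_vector_derivative[OF sol that]])
  have dv: "((\<lambda>s. time_deriv ?u s n) has_real_derivative
      coord (nonlin (2 * \<sigma>) (fst (y t)) - linop (fst (y t))) n) (at t)" if t: "t \<in> I" for t n
  \<comment> \<open>\<open>time_deriv\<close> is identified with the second component only at points
    of \<open>I\<close>, which suffices since \<open>I\<close> is open.\<close>
  proof (rule has_field_derivative_transform_within_open[OF _ I(1) t])
    show "((\<lambda>s. coord (snd (y s)) n) has_real_derivative
        coord (nonlin (2 * \<sigma>) (fst (y t)) - linop (fst (y t))) n) (at t)"
      unfolding has_real_derivative_iff_has_vector_derivative
      by (rule bounded_linear.has_vector_derivative[OF bounded_linear_coord snd_has_vector_derivative[OF sol t]])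
  qed (simp add: td)
  have cont: "continuous_on I (\<lambda>t. fst (y t))" "continuous_on I (\<lambda>t. snd (y t))"
    by (auto intro!: continuous_at_imp_continuous_on has_vector_derivative_continuous
        fst_has_vector_derivative[OF sol] snd_has_vector_derivative[OF sol])
  have "l2_continuous_on I ?u" "l2_continuous_on I (time_deriv ?u)"
    using l2_continuous_on_iff[of I ?u "\<lambda>t. fst (y t)"]
      l2_continuous_on_iff[of I "time_deriv ?u" "\<lambda>t. snd (y t)"] cont td by auto
  moreover have "time_deriv (time_deriv ?u) t n - discrete_laplacian h (?u t) n + V n * ?u t n
      - \<bar>?u t n\<bar> powr (2 * \<sigma>) * ?u t n = 0" if t: "t \<in> I" for t n
  proof -
    have "time_deriv (time_deriv ?u) t n = coord (nonlin (2 * \<sigma>) (fst (y t)) - linop (fst (y t))) n"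
      unfolding time_deriv_def[of "time_deriv ?u"] by (rule DERIV_imp_deriv[OF dv[OF t]])
    then show ?thesis unfolding coord_acceleration by simp
  qed
  moreover have "(\<lambda>s. ?u s n) differentiable (at t)" "(\<lambda>s. time_deriv ?u s n) differentiable (at t)"
    if "t \<in> I" for t n
    using dx[OF that] dv[OF that] real_differentiable_def by blast+
  ultimately show ?thesis
    using I fg td[OF I(3)] by (simp add: nlkg_solution_def coord_Abs_ell2_l2)
qed

end

section \<open>Blow-up by concavity\<close>

text \<open>As \<phi>'' is at least \<open>c\<close>, eventually \<phi>' and \<phi> are positive.
  From then on \<phi> to the power \<open>- a\<close> is concave with negative slope, so it would
  become negative in finite time.\<close>

lemma no_global_concavity:
  fixes \<phi> \<phi>' \<phi>'' :: "real \<Rightarrow> real"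
  assumes d1: "\<And>t. t \<ge> 0 \<Longrightarrow> (\<phi> has_real_derivative \<phi>' t) (at t)"
    and d2: "\<And>t. t \<ge> 0 \<Longrightarrow> (\<phi>' has_real_derivative \<phi>'' t) (at t)"
    and nonneg: "\<And>t. t \<ge> 0 \<Longrightarrow> 0 \<le> \<phi> t"
    and c: "c > 0" "\<And>t. t \<ge> 0 \<Longrightarrow> c \<le> \<phi>'' t"
    and a: "a > 0" "\<And>t. t \<ge> 0 \<Longrightarrow> (1 + a) * (\<phi>' t)\<^sup>2 \<le> \<phi> t * \<phi>'' t"
  shows False
proof -
  \<comment> \<open>By this time the growth \<open>c * t\<close> outweighs a negative \<phi>'(0),
    and \<phi>' is at least 1.\<close>
  define t1 where "t1 = (\<bar>\<phi>' 0\<bar> + 1) / c"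
  have t1: "t1 \<ge> 0" using c by (simp add: t1_def)
  have \<phi>'_pos: "\<phi>' t > 0" if t: "t \<ge> t1" for t
  proof -
    have "\<phi>' 0 - c * 0 \<le> \<phi>' t - c * t"
    proof (rule DERIV_nonneg_imp_nondecreasing[of 0 t "\<lambda>s. \<phi>' s - c * s"])
      fix s :: real assume "0 \<le> s"
      then show "\<exists>d. ((\<lambda>s. \<phi>' s - c * s) has_real_derivative d) (at s) \<and> 0 \<le> d"
        using c(2)[of s] by (intro exI[of _ "\<phi>'' s - c"]) (auto intro!: derivative_eq_intros d2)
    qed (use t t1 in simp)
    moreover have "c * t1 = \<bar>\<phi>' 0\<bar> + 1" using c by (simp add: t1_def)
    moreover have "c * t1 \<le> c * t" using t c by simp
    ultimately show ?thesis by linarith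
  qed
  have \<phi>_pos: "\<phi> t > 0" if t: "t > t1" for t
  proof -
    have "\<phi> t1 < \<phi> t"
    proof (rule DERIV_pos_imp_increasing[OF t])
      fix s assume "t1 \<le> s"
      then show "\<exists>d. (\<phi> has_real_derivative d) (at s) \<and> 0 < d"
        using d1[of s] \<phi>'_pos[of s] t1 by auto
    qed
    with nonneg[OF t1] show ?thesis by linarith
  qed
  \<comment> \<open>A point strictly beyond \<open>t1\<close>, since positivity of \<phi> is known
    only there.\<close>
  define t2 where "t2 = t1 + 1"
  \<comment> \<open>The derivative of \<phi> to the power \<open>- a\<close> is
    \<open>- a * q\<close>, so monotonicity of \<open>q\<close> is the concavity.\<close>
  define q where "q t = \<phi>' t * \<phi> t powr (- (1 + a))" for t
  have q_mono: "q t2 \<le> q t" if t: "t2 \<le> t" for t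
  proof (rule DERIV_nonneg_imp_nondecreasing[OF t])
    fix s assume "t2 \<le> s"
    then have s: "s \<ge> 0" "\<phi> s > 0" using t1 \<phi>_pos by (auto simp: t2_def)
    have "((\<lambda>s. \<phi> s powr (- (1 + a))) has_real_derivative
        - (1 + a) * \<phi> s powr (- (1 + a) - 1) * \<phi>' s) (at s)"
      using DERIV_fun_powr[OF d1[OF s(1)] s(2), of "- (1 + a)"] by simp
    from DERIV_mult[OF d2[OF s(1)] this]
    have "(q has_real_derivative \<phi>'' s * \<phi> s powr (- (1 + a))
        + - (1 + a) * \<phi> s powr (- (1 + a) - 1) * \<phi>' s * \<phi>' s) (at s)"
      by (simp add: q_def[abs_def])
    also have "\<phi> s powr (- (1 + a)) = \<phi> s * \<phi> s powr (- (1 + a) - 1)"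
      using powr_add[of "\<phi> s" 1 "- (1 + a) - 1"] s(2) by simp
    also have "\<phi>'' s * (\<phi> s * \<phi> s powr (- (1 + a) - 1))
        + - (1 + a) * \<phi> s powr (- (1 + a) - 1) * \<phi>' s * \<phi>' s
        = \<phi> s powr (- (1 + a) - 1) * (\<phi> s * \<phi>'' s - (1 + a) * (\<phi>' s)\<^sup>2)"
      by (simp add: power2_eq_square algebra_simps)
    finally show "\<exists>d. (q has_real_derivative d) (at s) \<and> 0 \<le> d"
      using a(2)[OF s(1)] by (intro exI conjI) auto
  qed
  define k where "k = q t2"
  have k: "k > 0"
    using \<phi>'_pos[of t2] \<phi>_pos[of t2] by (simp add: k_def q_def t2_def)
  \<comment> \<open>At \<open>t3\<close> the line of slope \<open>- a * k\<close> through the value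
    at \<open>t2\<close> has fallen to -1.\<close>
  define t3 where "t3 = t2 + (\<phi> t2 powr (- a) + 1) / (a * k)"
  have t3: "t2 \<le> t3" using a k by (simp add: t3_def)
  have "\<phi> t3 powr (- a) + a * k * t3 \<le> \<phi> t2 powr (- a) + a * k * t2"
  proof (rule DERIV_nonpos_imp_nonincreasing[OF t3])
    fix s assume s': "t2 \<le> s"
    then have s: "s \<ge> 0" "\<phi> s > 0" using t1 \<phi>_pos by (auto simp: t2_def)
    have "((\<lambda>s. \<phi> s powr (- a) + a * k * s) has_real_derivative
        - a * \<phi> s powr (- a - 1) * \<phi>' s + a * k * 1) (at s)"
      using DERIV_fun_powr[OF d1[OF s(1)] s(2), of "- a"]
      by (intro DERIV_add DERIV_cmult DERIV_ident) simp
    also have "- a - 1 = - (1 + a)" by simp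
    also have "- a * \<phi> s powr (- (1 + a)) * \<phi>' s + a * k * 1 = a * (k - q s)"
      by (simp add: q_def algebra_simps)
    finally show "\<exists>d. ((\<lambda>s. \<phi> s powr (- a) + a * k * s) has_real_derivative d) (at s) \<and> d \<le> 0"
      using q_mono[OF s'] a(1) by (intro exI conjI) (auto simp: k_def mult_nonneg_nonpos)
  qed
  moreover have "a * k * t3 = a * k * t2 + (\<phi> t2 powr (- a) + 1)"
    using a k by (simp add: t3_def field_simps)
  moreover have "0 \<le> \<phi> t3 powr (- a)" by simp
  ultimately show False by linarith
qed

section \<open>Energy conservation and its consequences\<close>

context lattice_nlkg
begin

text \<open>With \<open>N\<close> the nonlinear term and \<open>A\<close> the linear one, twice the
  energy has the derivative 2 \<langle>v, N - A\<rangle> + 2 \<langle>A, v\<rangle> - 2 \<langle>N,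
  v\<rangle> = 0. The middle term uses the symmetry of \<open>linop\<close>, the last one that (2
  \<sigma> + 2) / (\<sigma> + 1) = 2.\<close>

lemma total_energy_conserved:
  assumes sol: "ode_solution field (Abs_ell2 f, Abs_ell2 g) I y" and t: "t \<in> I"
  shows "total_energy (y t) = total_energy (Abs_ell2 f, Abs_ell2 g)"
proof -
  have I: "open I" "is_interval I" "0 \<in> I" "y 0 = (Abs_ell2 f, Abs_ell2 g)"
    using sol by (auto simp: ode_solution_def)
  have "((\<lambda>s. total_energy (y s)) has_real_derivative 0) (at s)" if s: "s \<in> I" for s
  proof -
    let ?x = "fst (y s)" and ?v = "snd (y s)"
    let ?N = "nonlin (2 * \<sigma>) ?x" and ?A = "linop ?x"
    have r: "2 * \<sigma> > 0" using \<sigma> by simp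
    note dx = fst_has_vector_derivative[OF sol s] and dv = snd_has_vector_derivative[OF sol s]
    have 1: "((\<lambda>s. inner (snd (y s)) (snd (y s))) has_vector_derivative
        inner ?v (?N - ?A) + inner (?N - ?A) ?v) (at s)"
      by (rule bounded_bilinear.has_vector_derivative[OF bounded_bilinear_inner dv dv])
    have 2: "((\<lambda>s. inner (linop (fst (y s))) (fst (y s))) has_vector_derivative
        inner ?A ?v + inner (linop ?v) ?x) (at s)"
      by (rule bounded_bilinear.has_vector_derivative[OF bounded_bilinear_inner
            bounded_linear.has_vector_derivative[OF bounded_linear_linop dx] dx])
    have 3: "((\<lambda>s. inner (nonlin (2 * \<sigma>) (fst (y s))) (fst (y s))) has_vector_derivative
        (2 * \<sigma> + 2) * inner ?N ?v) (at s)"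
      using diff_chain_at[OF dx[unfolded has_vector_derivative_def] potential_has_derivative[OF r]]
      by (simp add: has_vector_derivative_def o_def mult_ac)
    have "((\<lambda>s. total_energy (y s)) has_real_derivative
        1/2 * ((inner ?v (?N - ?A) + inner (?N - ?A) ?v + (inner ?A ?v + inner (linop ?v) ?x))
          - 1 / (\<sigma> + 1) * ((2 * \<sigma> + 2) * inner ?N ?v))) (at s)"
      unfolding total_energy_def
      using 1 2 3 unfolding has_real_derivative_iff_has_vector_derivative[symmetric]
      by (intro DERIV_cmult DERIV_diff DERIV_add)
    also have "1 / (\<sigma> + 1) * ((2 * \<sigma> + 2) * inner ?N ?v) = 2 * inner ?N ?v"
      using \<sigma> by (simp add: field_simps)
    also have "inner (linop ?v) ?x = inner ?A ?v"
      by (metis linop_symmetric inner_commute)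
    also have "1/2 * ((inner ?v (?N - ?A) + inner (?N - ?A) ?v + (inner ?A ?v + inner ?A ?v))
          - 2 * inner ?N ?v) = 0"
      by (simp add: inner_diff_left inner_diff_right inner_commute)
    finally show ?thesis .
  qed
  from has_field_derivative_at_within[OF this]
  have "\<exists>c. \<forall>s\<in>I. total_energy (y s) = c"
    by (rule has_field_derivative_zero_constant[OF is_interval_convex[OF I(2)]])
  then obtain c where "\<And>s. s \<in> I \<Longrightarrow> total_energy (y s) = c"
    by blast
  from this[OF t] this[OF I(3)] show ?thesis
    by (simp add: I(4))
qed

lemma negative_energy_bdd_above:
  assumes sol: "ode_solution field (Abs_ell2 f, Abs_ell2 g) I y"
    and E: "total_energy (Abs_ell2 f, Abs_ell2 g) < 0"
  shows "bdd_above I"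
proof (rule ccontr)
  assume unb: "\<not> bdd_above I"
  have I: "is_interval I" "0 \<in> I" using sol by (auto simp: ode_solution_def)
  have inI: "t \<in> I" if "t \<ge> 0" for t
  proof -
    obtain s where "s \<in> I" "t < s"
      using unb by (meson bdd_above.I not_le)
    then show ?thesis
      using I that mem_is_interval_1_I[of I 0 s t] by simp
  qed
  define E0 where "E0 = total_energy (Abs_ell2 f, Abs_ell2 g)"
  define x where "x t = fst (y t)" for t
  define v where "v t = snd (y t)" for t
  define w where "w t = nonlin (2 * \<sigma>) (x t) - linop (x t)" for t
  define \<phi>'' where "\<phi>'' t = 2 * inner (v t) (v t) + 2 * inner (x t) (w t)" for t
  have dx: "(x has_vector_derivative v t) (at t)" and dv: "(v has_vector_derivative w t) (at t)"
    if "t \<ge> 0" for t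
    using fst_has_vector_derivative[OF sol inI[OF that]] snd_has_vector_derivative[OF sol inI[OF that]]
    by (simp_all add: x_def[abs_def] v_def[abs_def] w_def)
  \<comment> \<open>Conservation of energy eliminates the potential term from the second derivative;
    the remaining multiple of the quadratic form is nonnegative and is dropped.\<close>
  have \<phi>'': "(2 * \<sigma> + 4) * inner (v t) (v t) - 4 * (\<sigma> + 1) * E0 \<le> \<phi>'' t" if t: "t \<ge> 0" for t
  proof -
    have "total_energy (y t) = E0"
      using total_energy_conserved[OF sol inI[OF t]] by (simp add: E0_def)
    then have "inner (nonlin (2 * \<sigma>) (x t)) (x t) / (\<sigma> + 1)
        = inner (v t) (v t) + inner (linop (x t)) (x t) - 2 * E0"
      by (simp add: total_energy_def x_def v_def)
    then have "inner (nonlin (2 * \<sigma>) (x t)) (x t)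
        = (\<sigma> + 1) * (inner (v t) (v t) + inner (linop (x t)) (x t) - 2 * E0)"
      using \<sigma> by (simp add: field_simps)
    then have "\<phi>'' t = (2 * \<sigma> + 4) * inner (v t) (v t) - 4 * (\<sigma> + 1) * E0
        + 2 * \<sigma> * inner (linop (x t)) (x t)"
      by (simp add: \<phi>''_def w_def inner_diff_right inner_commute[of "x t"] algebra_simps)
    then show ?thesis
      using quadratic_form_nonneg[of "x t"] \<sigma> by simp
  qed
  have E0: "4 * (\<sigma> + 1) * E0 < 0"
    using E \<sigma> by (simp add: E0_def mult_pos_neg)
  show False
  \<comment> \<open>The exponent a = \<sigma> / 2 is fitted to the factor of the kinetic term: 4 (1
    + a) = 2 \<sigma> + 4, so Cauchy-Schwarz gives the required inequality.\<close>
  proof (rule no_global_concavity[of "\<lambda>t. inner (x t) (x t)" "\<lambda>t. 2 * inner (x t) (v t)" \<phi>''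
        "- (4 * (\<sigma> + 1) * E0)" "\<sigma> / 2"])
    fix t :: real assume t: "t \<ge> 0"
    show "((\<lambda>t. inner (x t) (x t)) has_real_derivative 2 * inner (x t) (v t)) (at t)"
      using bounded_bilinear.has_vector_derivative[OF bounded_bilinear_inner dx[OF t] dx[OF t]]
      by (simp add: has_real_derivative_iff_has_vector_derivative inner_commute)
    have "((\<lambda>t. inner (x t) (v t)) has_real_derivative inner (x t) (w t) + inner (v t) (v t)) (at t)"
      using bounded_bilinear.has_vector_derivative[OF bounded_bilinear_inner dx[OF t] dv[OF t]]
      by (simp add: has_real_derivative_iff_has_vector_derivative)
    from DERIV_cmult[OF this, of 2]
    show "((\<lambda>t. 2 * inner (x t) (v t)) has_real_derivative \<phi>'' t) (at t)"
      by (simp add: \<phi>''_def algebra_simps)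
    have vv: "0 \<le> (2 * \<sigma> + 4) * inner (v t) (v t)" using \<sigma> by simp
    then show "- (4 * (\<sigma> + 1) * E0) \<le> \<phi>'' t" using \<phi>''[OF t] by linarith
    have "(1 + \<sigma> / 2) * (2 * inner (x t) (v t))\<^sup>2 = (2 * \<sigma> + 4) * (inner (x t) (v t))\<^sup>2"
      by (simp add: power_mult_distrib algebra_simps)
    also have "\<dots> \<le> (2 * \<sigma> + 4) * (inner (x t) (x t) * inner (v t) (v t))"
      using \<sigma> by (intro mult_left_mono Cauchy_Schwarz_ineq) auto
    also have "\<dots> = inner (x t) (x t) * ((2 * \<sigma> + 4) * inner (v t) (v t))" by simp
    also have "\<dots> \<le> inner (x t) (x t) * \<phi>'' t"
      using \<phi>''[OF t] E0 by (intro mult_left_mono) auto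
    finally show "(1 + \<sigma> / 2) * (2 * inner (x t) (v t))\<^sup>2 \<le> inner (x t) (x t) * \<phi>'' t" .
  qed (use \<sigma> E0 in auto)
qed

text \<open>For negative energy the kinetic and quadratic terms together are less than the potential
  divided by \<sigma> + 1, and the potential is controlled by the first component.\<close>

lemma negative_energy_norm_bound:
  assumes "total_energy p < 0"
  shows "(norm p)\<^sup>2 \<le> (norm (fst p))\<^sup>2 + norm (fst p) powr (2 * \<sigma>) * (norm (fst p))\<^sup>2"
proof -
  define P where "P = inner (nonlin (2 * \<sigma>) (fst p)) (fst p)"
  have "0 \<le> P"
    unfolding P_def by (rule has_sum_nonneg[OF has_sum_potential]) (use \<sigma> in auto)
  have "inner (snd p) (snd p) \<le> P / (\<sigma> + 1)"
    using assms quadratic_form_nonneg[of "fst p"] by (simp add: total_energy_def P_def)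
  also have "\<dots> \<le> P"
    using \<open>0 \<le> P\<close> \<sigma> by (simp add: divide_le_eq distrib_left)
  also have "\<dots> \<le> norm (fst p) powr (2 * \<sigma>) * (norm (fst p))\<^sup>2"
    unfolding P_def using \<sigma> by (intro potential_le) simp
  finally show ?thesis
    by (simp add: norm_prod_def power2_norm_eq_inner)
qed

lemma filterlim_norm_fst:
  assumes lim: "filterlim (\<lambda>t. norm (y t)) at_top F"
    and E: "\<forall>\<^sub>F t in F. total_energy (y t) < 0"
  shows "filterlim (\<lambda>t. norm (fst (y t))) at_top F"
  unfolding filterlim_at_top
proof
  fix Z :: real
  \<comment> \<open>The bound of \<open>negative_energy_norm_bound\<close> evaluated at norm
    \<bar>Z\<bar>; the absolute value keeps the base of \<open>powr\<close> nonnegative. A first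
    component below \<open>Z\<close> would force a norm of at most \<open>B\<close>, against the
    eventual bound \<open>B + 1\<close>.\<close>
  define B where "B = sqrt (Z\<^sup>2 + \<bar>Z\<bar> powr (2 * \<sigma>) * Z\<^sup>2)"
  have "\<forall>\<^sub>F t in F. B + 1 \<le> norm (y t)"
    using lim by (simp add: filterlim_at_top)
  with E show "\<forall>\<^sub>F t in F. Z \<le> norm (fst (y t))"
  proof eventually_elim
    case (elim t)
    show ?case
    proof (rule ccontr)
      let ?n = "norm (fst (y t))"
      assume "\<not> Z \<le> ?n"
      then have le: "?n \<le> \<bar>Z\<bar>" by simp
      have sq: "?n\<^sup>2 \<le> Z\<^sup>2"
        using power_mono[OF le, of 2] by simp
      have "(norm (y t))\<^sup>2 \<le> ?n\<^sup>2 + ?n powr (2 * \<sigma>) * ?n\<^sup>2"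
        by (rule negative_energy_norm_bound[OF elim(1)])
      also have "\<dots> \<le> Z\<^sup>2 + \<bar>Z\<bar> powr (2 * \<sigma>) * Z\<^sup>2"
        using \<sigma> le sq by (intro add_mono mult_mono powr_mono2) auto
      also have "\<dots> = B\<^sup>2" by (simp add: B_def)
      finally have "norm (y t) \<le> B"
        by (rule power2_le_imp_le) (simp add: B_def)
      with elim(2) show False by simp
    qed
  qed
qed

end

section \<open>Existence, uniqueness and blow-up on the lattice\<close>

theorem theorem1p6:
  fixes h \<sigma> :: real and V f g :: "int ^ 'd::finite \<Rightarrow> real"
  assumes "h > 0" and "\<sigma> > 0"
    and "bounded (range V)" and "(INF n. V n) > 0"
    and "f \<in> l2" and "g \<in> l2"
    and "energy h \<sigma> V f g < 0"
  shows "\<exists>I u. maximal_nlkg_solution h \<sigma> V f g I u \<and>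
           (\<forall>J w. maximal_nlkg_solution h \<sigma> V f g J w \<longrightarrow> J = I \<and> (\<forall>t\<in>I. w t = u t)) \<and>
           (\<exists>T. blows_up_at I u T \<and>
                filterlim (\<lambda>t. l2_norm (u t)) at_top (at_left T))"
proof -
  have "0 \<le> V n" for n
    using assms(4) cINF_lower[OF bounded_imp_bdd_below[OF assms(3)], of n] by simp
  then interpret lattice_nlkg h \<sigma> V
    using assms by unfold_locales auto
  define y0 where "y0 = (Abs_ell2 f, Abs_ell2 g)"
  obtain I y where sol: "ode_solution field y0 I y"
    and max: "\<And>J z. ode_solution field y0 J z \<Longrightarrow> J \<subseteq> I"
    and lim: "bdd_above I \<Longrightarrow> filterlim (\<lambda>t. norm (y t)) at_top (at_left (Sup I))"
    by (rule maximal_ode_solution[of y0]) (erule that)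
  note sol' = sol[unfolded y0_def]
  define u where "u t = coord (fst (y t))" for t
  have nlkg: "nlkg_solution h \<sigma> V f g I u"
    unfolding u_def[abs_def] by (rule ode_imp_nlkg_solution[OF assms(5,6) sol'])
  \<comment> \<open>Every lattice solution, maximal or not, is a restriction of \<open>u\<close>.
    This yields both the maximality of \<open>u\<close> and its uniqueness.\<close>
  have other: "J \<subseteq> I \<and> (\<forall>t\<in>J. w t = u t)" if w: "nlkg_solution h \<sigma> V f g J w" for J w
  proof (intro conjI ballI)
    have odew: "ode_solution field y0 J (\<lambda>t. (Abs_ell2 (w t), Abs_ell2 (time_deriv w t)))"
      unfolding y0_def by (rule nlkg_imp_ode_solution[OF w])
    then show sub: "J \<subseteq> I" by (rule max)
    fix t assume t: "t \<in> J"
    then have "w t \<in> l2"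
      using w by (simp add: nlkg_solution_def l2_continuous_on_def)
    moreover have "(Abs_ell2 (w t), Abs_ell2 (time_deriv w t)) = y t"
      using ode_solution_unique[OF odew sol t] t sub by auto
    ultimately show "w t = u t"
      by (metis coord_Abs_ell2_l2 fst_conv u_def)
  qed
  have maxu: "maximal_nlkg_solution h \<sigma> V f g I u"
    unfolding maximal_nlkg_solution_def using nlkg other by blast
  have uniq: "J = I \<and> (\<forall>t\<in>I. w t = u t)" if "maximal_nlkg_solution h \<sigma> V f g J w" for J w
  proof -
    have w: "nlkg_solution h \<sigma> V f g J w"
      \<comment> \<open>The maximality of \<open>w\<close>, tested against \<open>u\<close>.\<close>
      and "nlkg_solution h \<sigma> V f g I u \<and> J \<subseteq> I \<and> (\<forall>t\<in>J. u t = w t) \<longrightarrow> I = J"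
      using that unfolding maximal_nlkg_solution_def by blast+
    then have "I = J" using nlkg other[OF w] by simp
    then show ?thesis using other[OF w] by simp
  qed
  have E: "total_energy y0 < 0"
    using assms(5-7) energy_eq_total_energy[of "Abs_ell2 f" "Abs_ell2 g"]
    by (simp add: y0_def coord_Abs_ell2_l2)
  have bdd: "bdd_above I"
    by (rule negative_energy_bdd_above[OF sol' E[unfolded y0_def]])
  \<comment> \<open>Energy conservation holds on \<open>I\<close> only, so a left neighbourhood of
    the end point inside \<open>I\<close> is needed before limits are taken.\<close>
  have ev: "\<forall>\<^sub>F t in at_left (Sup I). t \<in> I"
  proof -
    have I: "open I" "is_interval I" "0 \<in> I" using sol by (auto simp: ode_solution_def)
    then obtain e where e: "e > 0" "cball 0 e \<subseteq> I" using open_contains_cball by blast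
    then have "e \<in> I" by (auto simp: subset_iff)
    then have "0 < Sup I" using cSup_upper[OF _ bdd] e by fastforce
    moreover have "t \<in> I" if t: "0 < t" "t < Sup I" for t
    proof -
      obtain s where "s \<in> I" "t < s"
        using t(2) I(3) less_cSupE[of t I] by blast
      then show ?thesis using I t mem_is_interval_1_I[of I 0 s t] by simp
    qed
    ultimately show ?thesis by (auto simp: eventually_at_left_field)
  qed
  have lim_u: "filterlim (\<lambda>t. l2_norm (u t)) at_top (at_left (Sup I))"
    unfolding u_def l2_norm_coord
  proof (rule filterlim_norm_fst[OF lim[OF bdd]])
    show "\<forall>\<^sub>F t in at_left (Sup I). total_energy (y t) < 0"
      using ev
    proof eventually_elim
      case (elim t)
      then show ?case
        using total_energy_conserved[OF sol' elim] E by (simp add: y0_def)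
    qed
  qed
  \<comment> \<open>The limit for \<open>u\<close> alone is the stronger statement; the pair norm
    dominates it and diverges as well.\<close>
  have "l2_norm (u t) \<le> l2_pair_norm (u t) (time_deriv u t)" for t
    unfolding l2_pair_norm_def by (rule real_le_rsqrt) simp
  then have "filterlim (\<lambda>t. l2_pair_norm (u t) (time_deriv u t)) at_top (at_left (Sup I))"
    by (intro filterlim_at_top_mono[OF lim_u]) simp
  then have "blows_up_at I u (Sup I)"
    using bdd by (simp add: blows_up_at_def)
  then show ?thesis
    using maxu uniq lim_u by blast
qed

end
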